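(* Let $q = p^m$ be odd, let $n \ge 1$, and let $F \in \mathrm{SQH}(n,q)$ with companion automorphism $\sigma \in \mathrm{Aut}(\mathbb{F}_q)$. (i) The polarization of $F$ is a (commutative) semifield if and only if (a) $F(\underline{x}) = \underline{0} \iff \underline{x} = \underline{0}$, and (b) $F$ is $2$-to-$1$ on $\mathbb{F}_q^n \setminus \{\underline{0}\}$. (ii) If (a) and (b) hold, then: if $n$ is odd, $\overline{F}$ is bijective on $\mathbb{P}^{n-1}(\mathbb{F}_q)$; if $n$ is even, $\overline{F}$ is $2$-to-$1$ on $\mathbb{P}^{n-1}(\mathbb{F}_q)$. (iii) If $\overline{F}$ is bijective on $\mathbb{P}^{n-1}(\mathbb{F}_q)$, then $F$ is $\gcd(\sigma+1,q-1)$-to-$1$ on $\mathbb{F}_q^n \setminus \{\underline{0}\}$.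
   Context: An automorphism $\sigma\in\mathrm{Aut}(\mathbb{F}_q)$, $q=p^m$, is identified with the integer $\sigma\in\{p^0,\dots,p^{m-1}\}$ such that it acts as $x\mapsto x^\sigma$. A $\sigma$-sesquilinear form $b:\mathbb{F}_q^n\times\mathbb{F}_q^n\to\mathbb{F}_q$ is linear in the first argument and $\sigma$-semilinear in the second (additive with $b(\underline{x},c\underline{y})=c^\sigma b(\underline{x},\underline{y})$). A $\sigma$-semiquadratic form $s:\mathbb{F}_q^n\to\mathbb{F}_q$ satisfies $s(c\underline{x})=c^{\sigma+1}s(\underline{x})$ and $s(\underline{x}+\underline{y})-s(\underline{x})-s(\underline{y})=b(\underline{x},\underline{y})+b(\underline{y},\underline{x})$ for some $\sigma$-sesquilinear $b$; equivalently $s(\underline{x})=\sum_{i,j}N_{ij}x_ix_j^\sigma$ with $N_{ij}\in\mathbb{F}_q$. $\mathrm{SQH}(n,q)$ is the set of maps $S=(S_1,\dots,S_n):\mathbb{F}_q^n\to\mathbb{F}_q^n$ whose components are all $\sigma$-semiquadratic forms for one fixed $\sigma\in\mathrm{Aut}(\mathbb{F}_q)$, called the companion automorphism. The polarization of $F$ is $\Delta_F(\underline{x},\underline{y})=F(\underline{x}+\underline{y})-F(\underline{x})-F(\underline{y})$; it "is a semifield" if it is a pre-semifield multiplication on $\mathbb{F}_q^n$, i.e. $\Delta_F(\underline{x},\underline{y})=0$ implies $\underline{x}=0$ or $\underline{y}=0$ (no identity element required; it is biadditive automatically). A map is $r$-to-$1$ on a set if every element of the image of that set has exactly $r$ preimages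 in that set. If $F(\underline{x})=0$ only for $\underline{x}=0$, then $\overline{F}:\mathbb{P}^{n-1}(\mathbb{F}_q)\to\mathbb{P}^{n-1}(\mathbb{F}_q)$ denotes the map induced by $F$ on projective space; writing $\overline{F}$ presupposes this condition. *)

theory Defs
  imports "HOL-Analysis.Cartesian_Space" "HOL-Computational_Algebra.Primes"
begin

definition sesquilinear_form :: "nat \<Rightarrow> ('a::field ^ 'n \<Rightarrow> 'a ^ 'n \<Rightarrow> 'a) \<Rightarrow> bool" where
  "sesquilinear_form \<sigma> b \<longleftrightarrow>
     (\<forall>y. Vector_Spaces.linear (*s) (*) (\<lambda>x. b x y)) \<and>
     (\<forall>x. additive (b x) \<and> (\<forall>c y. b x (c *s y) = c ^ \<sigma> * b x y))"

definition semiquadratic_form :: "nat \<Rightarrow> ('a::field ^ 'n \<Rightarrow> 'a) \<Rightarrow> bool" where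
  "semiquadratic_form \<sigma> s \<longleftrightarrow>
     (\<forall>c x. s (c *s x) = c ^ (\<sigma> + 1) * s x) \<and>
     (\<exists>b. sesquilinear_form \<sigma> b \<and> (\<forall>x y. s (x + y) - s x - s y = b x y + b y x))"

(* The maps with companion automorphism x \<mapsto> x ^ \<sigma>; the set SQH(n,q) is the union
   of these over the exponents \<sigma> = p ^ i, i < m, where q = p ^ m. *)
definition SQH :: "nat \<Rightarrow> ('a::field ^ 'n \<Rightarrow> 'a ^ 'n) set" where
  "SQH \<sigma> = {F. \<forall>i. semiquadratic_form \<sigma> (\<lambda>x. F x $ i)}"

definition polarization :: "('v::ab_group_add \<Rightarrow> 'w::ab_group_add) \<Rightarrow> 'v \<Rightarrow> 'v \<Rightarrow> 'w" where
  "polarization F x y = F (x + y) - F x - F y"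

definition commutative_presemifield :: "('v::ab_group_add \<Rightarrow> 'v \<Rightarrow> 'v) \<Rightarrow> bool" where
  "commutative_presemifield m \<longleftrightarrow>
     (\<forall>y. additive (\<lambda>x. m x y)) \<and> (\<forall>x. additive (m x)) \<and>
     (\<forall>x y. m x y = m y x) \<and>
     (\<forall>x y. m x y = 0 \<longrightarrow> x = 0 \<or> y = 0)"

definition to_1_on :: "nat \<Rightarrow> ('b \<Rightarrow> 'c) \<Rightarrow> 'b set \<Rightarrow> bool" where
  "to_1_on r f A \<longleftrightarrow> (\<forall>y \<in> f ` A. card {x \<in> A. f x = y} = r)"

definition proj_space :: "('a::field ^ 'n) set set" where
  "proj_space = {L. vec.subspace L \<and> vec.dim L = 1}"

(* The point spanned by x goes to the point spanned by F x. Taking the span of the image of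
   the whole line avoids choosing a representative; see induced_map_span. *)
definition induced_map :: "('a::field ^ 'n \<Rightarrow> 'a ^ 'n) \<Rightarrow> ('a ^ 'n) set \<Rightarrow> ('a ^ 'n) set" where
  "induced_map F L = vec.span (F ` L)"

lemma SQH_scale:
  assumes "F \<in> SQH \<sigma>"
  shows "F (c *s x) = c ^ (\<sigma> + 1) *s F x"
  using assms by (simp add: SQH_def semiquadratic_form_def vec_eq_iff)

lemma induced_map_span:
  assumes "F \<in> SQH \<sigma>"
  shows "induced_map F (vec.span {x}) = vec.span {F x}"
proof (rule antisym)
  have "F ` vec.span {x} \<subseteq> vec.span {F x}"
    using SQH_scale[OF assms] by (auto simp: vec.span_singleton)
  then show "induced_map F (vec.span {x}) \<subseteq> vec.span {F x}"
    unfolding induced_map_def by (simp add: vec.span_minimal)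
  show "vec.span {F x} \<subseteq> induced_map F (vec.span {x})"
    unfolding induced_map_def by (intro vec.span_mono) (auto intro: vec.span_base)
qed

lemma proj_space_eq: "proj_space = {vec.span {x} | x. x \<noteq> 0}"
proof (intro equalityI subsetI)
  fix L :: "('a ^ 'n) set"
  assume "L \<in> proj_space"
  then have L: "vec.subspace L" "vec.dim L = 1" by (auto simp: proj_space_def)
  obtain B where B: "B \<subseteq> L" "vec.independent B" "L \<subseteq> vec.span B" "card B = vec.dim L"
    using vec.basis_exists by blast
  then obtain x where x: "B = {x}" using L card_1_singletonE by metis
  have "vec.span B = L" using B L vec.span_subspace by blast
  moreover have "x \<noteq> 0" using B x vec.dependent_zero by blast
  ultimately show "L \<in> {vec.span {x} | x. x \<noteq> 0}" using x by blast
next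
  fix L :: "('a ^ 'n) set"
  assume "L \<in> {vec.span {x} | x. x \<noteq> 0}"
  then obtain x where "L = vec.span {x}" "x \<noteq> 0" by blast
  then show "L \<in> proj_space"
    by (simp add: proj_space_def vec.dim_eq_card_independent)
qed

lemma induced_map_proj_space:
  assumes "F \<in> SQH \<sigma>" and "\<And>x. F x = 0 \<Longrightarrow> x = 0" and "L \<in> proj_space"
  shows "induced_map F L \<in> proj_space"
  using assms by (force simp: proj_space_eq induced_map_span[OF assms(1)])

end

(* Since q is odd, the polarization D satisfies D x x = 2 F x, hence D (x + y) (x - y) = 2 (F x - F y),
   which gives (i). For (ii), let k denote the fixed field of the companion automorphism. Property (b)
   forces c ^ (\<sigma> + 1) = 1 only for c = 1 and c = -1; hence the powers c ^ (\<sigma> + 1) are exactly the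
   squares, every nonsquare l of k stays a nonsquare in the whole field, and the degree over k is odd.
   Composing F with a nonzero k-linear functional gives a non-degenerate quadratic form over k, and
   scaling by l multiplies its value distribution (up to the uniform part) by (-1)^n. Inverting over
   all functionals shows that l F y has 1 + (-1)^n preimages whenever y is nonzero. For (iii), vectors
   with equal image are proportional, by a (\<sigma> + 1)-st root of unity. *)
theory Submission
  imports Defs "HOL-Computational_Algebra.Polynomial"
begin

section \<open>Squares in finite subfields\<close>

text \<open>A scalar \<open>c\<close> acts on values of \<open>F\<close> by
  \<open>c ^ (\<sigma> + 1)\<close>, which is the square of \<open>c\<close> exactly when
  \<open>c\<close> is in \<open>k\<close> or zero; so \<open>F\<close> is quadratic over
  \<open>k\<close> only. The sign of the comparison is therefore (-1) to the dimension over
  \<open>k\<close>, that is, n times the degree of the field over \<open>k\<close>, and it reduces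
  to (-1)^n only because that degree is odd. An even degree would turn every element of
  \<open>k\<close> into a square, so the oddness rests on a single nonsquare of \<open>k\<close>
  surviving. Only the ratio between the value distributions of a form and of \<open>l\<close> times
  that form enters. Hence real weights with sum 0 on \<open>k\<close> can play the role of
  nontrivial additive characters. In 1 + (-1)^n the summand 1 is the average fibre size. The fibre
  over \<open>F y\<close> is \<open>{y, - y}\<close> and exceeds this average by 1; the fibre over
  \<open>l *s F y\<close> deviates by the same amount up to the sign. The gcd in (iii) is the number
  of (\<sigma> + 1)-st roots of unity in the field.\<close>

lemma card_le_mult_fibre:
  assumes "finite A" "finite B" "f ` A \<subseteq> B" "\<And>y. y \<in> B \<Longrightarrow> card {x \<in> A. f x = y} \<le> r"
  shows "card A \<le> r * card B"
proof -
  have "card A = (\<Sum>y\<in>B. card {x \<in> A. f x = y})"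
    using sum_fun_comp[OF assms(1-3), of "\<lambda>_. 1::nat"] by simp
  also have "\<dots> \<le> (\<Sum>y\<in>B. r)"
    by (rule sum_mono) (use assms(4) in auto)
  finally show ?thesis by (simp add: mult.commute)
qed

lemma card_to_1_on:
  assumes "to_1_on r f A" "finite A"
  shows "card A = r * card (f ` A)"
proof -
  have "card A = (\<Sum>y\<in>f ` A. card {x \<in> A. f x = y})"
    using sum_fun_comp[OF assms(2), of "f ` A" f "\<lambda>_. 1::nat"] assms(2) by simp
  also have "\<dots> = (\<Sum>y\<in>f ` A. r)"
    by (rule sum.cong) (use assms(1) in \<open>auto simp: to_1_on_def\<close>)
  finally show ?thesis by (simp add: mult.commute)
qed

text \<open>Fermat's argument: multiplication by \<open>x\<close> permutes \<open>k - {0}\<close>,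
  so it leaves the product of these elements unchanged, while contributing one factor
  \<open>x\<close> for each of them.\<close>

lemma power_card_minus_1_eq_1:
  fixes x :: "'a::field"
  assumes "finite k" "0 \<in> k" "x \<noteq> 0"
    and "\<And>y. y \<in> k \<Longrightarrow> x * y \<in> k" "\<And>y. y \<in> k \<Longrightarrow> y / x \<in> k"
  shows "x ^ (card k - 1) = 1"
proof -
  have "x ^ (card k - 1) * \<Prod>(k - {0}) = (\<Prod>y\<in>k - {0}. x * y)"
    using assms(1,2) by (simp add: prod.distrib)
  also have "\<dots> = \<Prod>(k - {0})"
    by (rule prod.reindex_bij_witness[of _ "\<lambda>y. y / x" "\<lambda>y. x * y"])
       (use assms(3-5) in auto)
  finally show ?thesis
    using assms(1) by simp
qed

text \<open>A subfield is a set inside the type, so that the fixed field of the automorphism and the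
  whole field \<open>UNIV\<close> are both instances.\<close>

locale finite_subfield =
  fixes k :: "'a::field set"
  assumes finite: "finite k"
    and one: "1 \<in> k"
    and diff: "x \<in> k \<Longrightarrow> y \<in> k \<Longrightarrow> x - y \<in> k"
    and mult: "x \<in> k \<Longrightarrow> y \<in> k \<Longrightarrow> x * y \<in> k"
    and inverse: "x \<in> k \<Longrightarrow> inverse x \<in> k"
    and two_neq_0: "(2::'a) \<noteq> 0"
begin

lemma zero: "0 \<in> k"
  using diff[OF one one] by simp

lemma uminus: "x \<in> k \<Longrightarrow> - x \<in> k"
  using diff[OF zero, of x] by simp

lemma add: "x \<in> k \<Longrightarrow> y \<in> k \<Longrightarrow> x + y \<in> k"
  using diff[of x "- y"] uminus[of y] by simp

lemma divide: "x \<in> k \<Longrightarrow> y \<in> k \<Longrightarrow> x / y \<in> k"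
  by (simp add: divide_inverse mult inverse)

lemma square: "x \<in> k \<Longrightarrow> x\<^sup>2 \<in> k"
  by (simp add: power2_eq_square mult)

lemma neq_uminus: "(x::'a) \<noteq> 0 \<Longrightarrow> x \<noteq> - x"
  using two_neq_0 by (metis add_eq_0_iff mult_2 mult_eq_0_iff)

lemma card_ge_3: "card k \<ge> 3"
proof -
  have "card {0, 1, - 1 :: 'a} = 3"
    using neq_uminus[of 1] by (simp add: card_insert_if)
  then show ?thesis
    using card_mono[OF finite, of "{0, 1, - 1}"] zero one uminus[OF one] by simp
qed

lemma power_card_minus_1:
  assumes "x \<in> k" "x \<noteq> 0"
  shows "x ^ (card k - 1) = 1"
  using assms by (intro power_card_minus_1_eq_1 finite zero mult divide)

lemma square_to_1: "to_1_on 2 (\<lambda>x. x\<^sup>2) (k - {0})"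
  unfolding to_1_on_def
proof
  fix y assume "y \<in> (\<lambda>x. x\<^sup>2) ` (k - {0})"
  then obtain x where x: "x \<in> k" "x \<noteq> 0" "y = x\<^sup>2" by blast
  then have "{z \<in> k - {0}. z\<^sup>2 = y} = {x, - x}"
    by (auto simp: power2_eq_iff uminus)
  then show "card {z \<in> k - {0}. z\<^sup>2 = y} = 2"
    using neq_uminus[OF x(2)] by simp
qed

lemma card_squares: "card k - 1 = 2 * card ((\<lambda>x. x\<^sup>2) ` (k - {0}))"
  using card_to_1_on[OF square_to_1] finite zero by simp

lemma exists_nonsquare:
  obtains l where "l \<in> k" "l \<notin> (\<lambda>x. x\<^sup>2) ` k"
proof -
  have "\<not> inj_on (\<lambda>x. x\<^sup>2) k"
    using neq_uminus[of 1] one uminus[OF one] by (force simp: inj_on_def)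
  then have "(\<lambda>x. x\<^sup>2) ` k \<noteq> k"
    using finite eq_card_imp_inj_on by metis
  then show ?thesis
    using that square by auto
qed

text \<open>The nonzero squares make up half of \<open>k - {0}\<close>; their multiples by
  \<open>l\<close> are disjoint from them and equally many, hence they are the other half.\<close>

lemma nonsquare_mult_square:
  assumes "l \<in> k" "l \<notin> (\<lambda>x. x\<^sup>2) ` k" "m \<in> k" "m \<notin> (\<lambda>x. x\<^sup>2) ` k"
  obtains t where "t \<in> k" "t \<noteq> 0" "m = l * t\<^sup>2"
proof -
  let ?S = "(\<lambda>x. x\<^sup>2) ` (k - {0})"
  have l0: "l \<noteq> 0" using assms(2) zero by force
  have m0: "m \<noteq> 0" using assms(4) zero by force
  have fin: "finite ?S" using finite by simp
  have sub: "?S \<union> (*) l ` ?S \<subseteq> k - {0}"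
    using l0 assms(1) by (auto simp: square mult)
  have disj: "?S \<inter> (*) l ` ?S = {}"
  proof (rule ccontr)
    assume "?S \<inter> (*) l ` ?S \<noteq> {}"
    then obtain x y where "x \<in> k" "y \<in> k" "y \<noteq> 0" "x\<^sup>2 = l * y\<^sup>2" by force
    then have "l = (x / y)\<^sup>2" "x / y \<in> k"
      by (auto simp: power_divide divide)
    then show False using assms(2) by blast
  qed
  have "card ((*) l ` ?S) = card ?S"
    by (rule card_image) (use l0 in \<open>auto simp: inj_on_def\<close>)
  then have "card (?S \<union> (*) l ` ?S) = card (k - {0})"
    using card_Un_disjoint[OF fin _ disj] fin card_squares finite zero by simp
  then have "?S \<union> (*) l ` ?S = k - {0}"
    using card_subset_eq[OF _ sub] finite by simp
  then have "m \<in> (*) l ` ?S"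
    using assms(3,4) m0 by blast
  then show ?thesis using that by blast
qed

text \<open>Each element of \<open>k\<close> is taken exactly twice in total: zero once by either
  family, a nonzero square twice by the first, a nonsquare twice by the second.\<close>

lemma sum_squares_nonsquare:
  fixes g :: "'a \<Rightarrow> real"
  assumes "l \<in> k" "l \<notin> (\<lambda>x. x\<^sup>2) ` k"
  shows "(\<Sum>t\<in>k. g (t\<^sup>2)) + (\<Sum>t\<in>k. g (l * t\<^sup>2)) = 2 * sum g k"
proof -
  have l0: "l \<noteq> 0" using assms(2) zero by force
  have card2: "card {t \<in> k. t\<^sup>2 = c} + card {t \<in> k. l * t\<^sup>2 = c} = 2" if c: "c \<in> k" for c
  proof -
    consider "c = 0" | x where "x \<in> k" "x \<noteq> 0" "c = x\<^sup>2" | "c \<notin> (\<lambda>x. x\<^sup>2) ` k"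
    proof (cases "c \<in> (\<lambda>x. x\<^sup>2) ` k - {0}")
      case True
      then obtain x where "x \<in> k" "c = x\<^sup>2" "x \<noteq> 0" by auto
      then show ?thesis using that(2) by blast
    qed (use that in blast)
    then show ?thesis
    proof cases
      case 1
      have "{t \<in> k. t = 0} = {0}" using zero by auto
      then show ?thesis using 1 l0 by simp
    next
      case 2
      have "{t \<in> k. t\<^sup>2 = c} = {x, - x}"
        using 2 by (auto simp: power2_eq_iff uminus)
      moreover have "l * t\<^sup>2 \<noteq> c" if "t \<in> k" for t
      proof
        assume "l * t\<^sup>2 = c"
        then have "t \<noteq> 0" using 2 by auto
        then have "l = (x / t)\<^sup>2" using \<open>l * t\<^sup>2 = c\<close> 2 by (simp add: power_divide field_simps)
        then show False using assms(2) divide[OF 2(1) that] by blast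
      qed
      then have E: "{t \<in> k. l * t\<^sup>2 = c} = {}" by blast
      ultimately show ?thesis unfolding E using neq_uminus[OF 2(2)] by simp
    next
      case 3
      then obtain x where x: "x \<in> k" "x \<noteq> 0" "c = l * x\<^sup>2"
        using nonsquare_mult_square[OF assms c] by blast
      have "{t \<in> k. l * t\<^sup>2 = c} = {x, - x}"
        using x l0 by (auto simp: power2_eq_iff uminus)
      moreover have E: "{t \<in> k. t\<^sup>2 = c} = {}" using 3 by blast
      ultimately show ?thesis unfolding E using neq_uminus[OF x(2)] by simp
    qed
  qed
  have *: "real (card {t \<in> k. t\<^sup>2 = c}) + real (card {t \<in> k. l * t\<^sup>2 = c}) = 2"
    if "c \<in> k" for c
    using arg_cong[OF card2[OF that], of real] by simp
  have "(\<Sum>t\<in>k. g (t\<^sup>2)) + (\<Sum>t\<in>k. g (l * t\<^sup>2)) =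
      (\<Sum>c\<in>k. real (card {t \<in> k. t\<^sup>2 = c}) * g c) + (\<Sum>c\<in>k. real (card {t \<in> k. l * t\<^sup>2 = c}) * g c)"
    using sum_fun_comp[OF finite finite, of "\<lambda>t. t\<^sup>2" g]
      sum_fun_comp[OF finite finite, of "\<lambda>t. l * t\<^sup>2" g] assms(1)
    by (simp add: image_subset_iff square mult)
  also have "\<dots> = (\<Sum>c\<in>k. 2 * g c)"
    unfolding sum.distrib[symmetric] distrib_right[symmetric]
    by (rule sum.cong) (simp_all add: *)
  finally show ?thesis by (simp add: sum_distrib_left)
qed

lemma sum_affine:
  assumes "s \<in> k" "a \<in> k" "a \<noteq> 0"
  shows "(\<Sum>c\<in>k. g (s + a * c)) = sum g k"
  by (rule sum.reindex_bij_witness[of _ "\<lambda>c. (c - s) / a" "\<lambda>c. s + a * c"])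
     (use assms in \<open>auto intro: add mult divide diff\<close>)

text \<open>A maximal proper \<open>k\<close>-subspace avoiding \<open>1\<close> is a complement of \<open>k\<close>;
  \<open>\<phi>\<close> is the projection onto \<open>k\<close> along it.\<close>

lemma exists_functional:
  assumes "finite (UNIV :: 'a set)"
  obtains \<phi> :: "'a \<Rightarrow> 'a" where "\<And>x. \<phi> x \<in> k" "\<And>x y. \<phi> (x + y) = \<phi> x + \<phi> y"
    "\<And>c x. c \<in> k \<Longrightarrow> \<phi> (c * x) = c * \<phi> x" "\<phi> 1 = 1"
proof -
  define S where "S = {M. 0 \<in> M \<and> 1 \<notin> M \<and> (\<forall>x\<in>M. \<forall>y\<in>M. x + y \<in> M) \<and> (\<forall>c\<in>k. \<forall>x\<in>M. c * x \<in> M)}"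
  have "{0} \<in> S" by (auto simp: S_def)
  moreover have "finite S"
    using assms by (meson finite_subset finite_Pow_iff subset_Pow_Union subset_UNIV Finite_Set.finite_set finite)
  ultimately obtain M where M: "M \<in> S" and max: "\<And>M'. M' \<in> S \<Longrightarrow> M \<subseteq> M' \<Longrightarrow> M = M'"
    using finite_has_maximal[of S] by blast
  have M0: "0 \<in> M" and M1: "1 \<notin> M" and Madd: "\<And>x y. x \<in> M \<Longrightarrow> y \<in> M \<Longrightarrow> x + y \<in> M"
    and Mscale: "\<And>c x. c \<in> k \<Longrightarrow> x \<in> M \<Longrightarrow> c * x \<in> M"
    using M by (auto simp: S_def)
  have Mdiff: "x - y \<in> M" if "x \<in> M" "y \<in> M" for x y
    using Madd[OF that(1) Mscale[OF uminus[OF one] that(2)]] by simp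
  have ex: "\<exists>c\<in>k. x - c \<in> M" for x
  proof (cases "x \<in> M")
    case True
    then show ?thesis using zero by (intro bexI[of _ 0]) auto
  next
    case False
    \<comment> \<open>The span of \<open>M\<close> and \<open>x\<close> is strictly larger than
      \<open>M\<close>, so maximality puts \<open>1\<close> into it; the resulting equation is then
      solved for \<open>x\<close> modulo \<open>M\<close>.\<close>
    define M' where "M' = {m + c * x | m c. m \<in> M \<and> c \<in> k}"
    have sub: "M \<subseteq> M'"
      unfolding M'_def using zero by force
    have "0 + 1 * x \<in> M'"
      unfolding M'_def using M0 one by blast
    then have neq: "M \<noteq> M'" using False by auto
    have "0 \<in> M'" using sub M0 by blast
    moreover have "y + z \<in> M'" if "y \<in> M'" "z \<in> M'" for y z
    proof -
      obtain m c m' c' where "m \<in> M" "c \<in> k" "m' \<in> M" "c' \<in> k" "y = m + c * x" "z = m' + c' * x"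
        using \<open>y \<in> M'\<close> \<open>z \<in> M'\<close> unfolding M'_def by blast
      then have "y + z = (m + m') + (c + c') * x" "m + m' \<in> M" "c + c' \<in> k"
        by (auto simp: algebra_simps Madd add)
      then show ?thesis unfolding M'_def by blast
    qed
    moreover have "d * y \<in> M'" if "d \<in> k" "y \<in> M'" for d y
    proof -
      obtain m c where "m \<in> M" "c \<in> k" "y = m + c * x"
        using \<open>y \<in> M'\<close> unfolding M'_def by blast
      then have "d * y = d * m + (d * c) * x" "d * m \<in> M" "d * c \<in> k"
        using \<open>d \<in> k\<close> by (auto simp: algebra_simps Mscale mult)
      then show ?thesis unfolding M'_def by blast
    qed
    ultimately have "1 \<in> M'"
      using max[OF _ sub] neq unfolding S_def by blast
    then obtain m c where mc: "m \<in> M" "c \<in> k" "1 = m + c * x"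
      unfolding M'_def by blast
    then have c0: "c \<noteq> 0" using M1 by auto
    have "c * x = 1 - m" using mc(3) by (metis add_diff_cancel_left')
    then have x: "x = (1 - m) / c" using c0 by (metis nonzero_mult_div_cancel_left)
    have "x - inverse c = (- inverse c) * m"
      unfolding x using c0 by (simp add: field_simps)
    then show ?thesis
      using Mscale[OF uminus[OF inverse[OF mc(2)]] mc(1)] inverse[OF mc(2)] by metis
  qed
  \<comment> \<open>\<open>M\<close> meets \<open>k\<close> only in zero: a nonzero element of both
    could be scaled to \<open>1\<close>.\<close>
  have uniq: "c = d" if "c \<in> k" "d \<in> k" "x - c \<in> M" "x - d \<in> M" for c d x
  proof (rule ccontr)
    assume "c \<noteq> d"
    have "d - c \<in> M" using Mdiff[OF that(3,4)] by simp
    then have "inverse (d - c) * (d - c) \<in> M"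
      by (intro Mscale inverse diff that)
    then show False using M1 \<open>c \<noteq> d\<close> by simp
  qed
  obtain \<phi> where phi: "\<And>x. \<phi> x \<in> k" "\<And>x. x - \<phi> x \<in> M"
    using ex by metis
  show ?thesis
  proof
    show "\<phi> x \<in> k" for x by (fact phi)
    show "\<phi> (x + y) = \<phi> x + \<phi> y" for x y
    proof (rule uniq[of _ _ "x + y"])
      show "x + y - (\<phi> x + \<phi> y) \<in> M"
        using Madd[OF phi(2) phi(2), of x y] by (simp add: algebra_simps)
    qed (auto intro: phi add)
    show "\<phi> (c * x) = c * \<phi> x" if "c \<in> k" for c x
    proof (rule uniq[of _ _ "c * x"])
      show "c * x - c * \<phi> x \<in> M"
        using Mscale[OF that phi(2), of x] by (simp add: algebra_simps)
    qed (auto intro: phi mult that)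
    show "\<phi> 1 = 1"
      by (rule uniq[of _ _ 1]) (auto intro: phi one simp: M0)
  qed
qed

section \<open>Value distribution of quadratic forms\<close>

text \<open>This replaces the evaluation of quadratic Gauss sums. The induction splits off one vector
  \<open>v\<close> from its orthogonal complement; each \<open>v\<close> contributes the sign \<open>-1\<close>, because
  \<open>t\<^sup>2\<close> and \<open>l t\<^sup>2\<close> together cover \<open>k\<close> exactly twice.\<close>

lemma quadratic_sum_nonsquare:
  fixes scale :: "'a \<Rightarrow> 'v::ab_group_add \<Rightarrow> 'v" (infixr \<open>*\<^sub>V\<close> 75) and B :: "'v \<Rightarrow> 'v \<Rightarrow> 'a"
  assumes "vector_space scale"
    and l: "l \<in> k" "l \<notin> (\<lambda>t. t\<^sup>2) ` k"
    and "finite U" "0 \<in> U"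
    and "\<And>x y. x \<in> U \<Longrightarrow> y \<in> U \<Longrightarrow> x + y \<in> U"
    and "\<And>c x. c \<in> k \<Longrightarrow> x \<in> U \<Longrightarrow> c *\<^sub>V x \<in> U"
    and Bk: "\<And>x y. B x y \<in> k"
    and Badd: "\<And>x y z. B (x + y) z = B x z + B y z"
    and Bscale: "\<And>c x y. c \<in> k \<Longrightarrow> B (c *\<^sub>V x) y = c * B x y"
    and Bsym: "\<And>x y. B x y = B y x"
    and "\<And>x. x \<in> U \<Longrightarrow> (\<And>y. y \<in> U \<Longrightarrow> B x y = 0) \<Longrightarrow> x = 0"
  shows "\<exists>N. card U = card k ^ N \<and>
    (\<forall>g :: 'a \<Rightarrow> real. sum g k = 0 \<longrightarrow>
      (\<Sum>x\<in>U. g (l * B x x)) = (- 1) ^ N * (\<Sum>x\<in>U. g (B x x)))"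
  using assms(4-7,12)
proof (induction U rule: finite_psubset_induct)
  case (psubset U)
  interpret vector_space scale by fact
  note U0 = psubset.prems(1) and Uadd = psubset.prems(2) and Uscale = psubset.prems(3)
    and nondeg = psubset.prems(4)
  have B0: "B 0 y = 0" for y
    using Badd[of 0 0 y] by (metis add_0_left add_cancel_right_left)
  have Badd2: "B x (y + z) = B x y + B x z" for x y z
    using Badd[of y z x] by (simp add: Bsym)
  have Bscale2: "B x (c *\<^sub>V y) = c * B x y" if "c \<in> k" for c x y
    using Bscale[OF that, of y x] by (simp add: Bsym)
  show ?case
  proof (cases "U = {0}")
    case True
    then show ?thesis by (intro exI[of _ 0]) (simp add: B0)
  next
    case False
    then obtain x0 where x0: "x0 \<in> U" "x0 \<noteq> 0" using U0 by blast
    \<comment> \<open>In odd characteristic a symmetric form with zero diagonal vanishes, which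
      non-degeneracy excludes on \<open>U\<close>.\<close>
    have "\<exists>v\<in>U. B v v \<noteq> 0"
    proof (rule ccontr)
      assume "\<not> ?thesis"
      then have *: "B v v = 0" if "v \<in> U" for v using that by blast
      have "B x0 y = 0" if "y \<in> U" for y
      proof -
        have "0 = B (x0 + y) (x0 + y)"
          using *[OF Uadd[OF x0(1) that]] by simp
        also have "\<dots> = (B x0 x0 + B x0 y) + (B x0 y + B y y)"
          by (simp only: Badd Badd2 Bsym[of y x0])
        finally have "2 * B x0 y = 0"
          by (simp only: *[OF x0(1)] *[OF that] mult_2 add_0_left add_0_right)
        then show ?thesis using two_neq_0 by simp
      qed
      then show False using nondeg x0 by blast
    qed
    then obtain v where v: "v \<in> U" "B v v \<noteq> 0" by blast
    define a where "a = B v v"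
    have a: "a \<in> k" "a \<noteq> 0" using v Bk by (auto simp: a_def)
    define U' where "U' = {u \<in> U. B u v = 0}"
    have sub: "U' \<subset> U" using v by (auto simp: U'_def)
    have fin: "finite U'" using sub psubset.hyps finite_subset by blast
    have U'D: "u \<in> U" "B u v = 0" "B v u = 0" if "u \<in> U'" for u
      using that by (auto simp: U'_def Bsym[of v])
    have proj: "x + (- (B x v / a)) *\<^sub>V v \<in> U'" "B x v / a \<in> k" if "x \<in> U" for x
    proof -
      show k: "B x v / a \<in> k" by (intro divide Bk a)
      have "B (x + (- (B x v / a)) *\<^sub>V v) v = 0"
        using a by (simp only: Badd Bscale[OF uminus[OF k]]) (simp add: a_def)
      then show "x + (- (B x v / a)) *\<^sub>V v \<in> U'"
        unfolding U'_def using Uadd[OF that Uscale[OF uminus[OF k] v(1)]] by simp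
    qed
    have "\<exists>N. card U' = card k ^ N \<and>
      (\<forall>g :: 'a \<Rightarrow> real. sum g k = 0 \<longrightarrow>
        (\<Sum>x\<in>U'. g (l * B x x)) = (- 1) ^ N * (\<Sum>x\<in>U'. g (B x x)))"
    proof (rule psubset.IH[OF sub])
      show "0 \<in> U'" by (simp add: U'_def U0 B0)
      show "x + y \<in> U'" if "x \<in> U'" "y \<in> U'" for x y
        using that by (simp add: U'_def Uadd Badd)
      show "c *\<^sub>V x \<in> U'" if "c \<in> k" "x \<in> U'" for c x
        using that by (simp add: U'_def Uscale Bscale)
      show "x = 0" if "x \<in> U'" and *: "\<And>y. y \<in> U' \<Longrightarrow> B x y = 0" for x
      proof (rule nondeg)
        show "x \<in> U" using U'D that by blast
        show "B x y = 0" if "y \<in> U" for y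
          using *[OF proj(1)[OF that]] U'D(2)[OF \<open>x \<in> U'\<close>]
          by (simp only: Badd2 Bscale2[OF uminus[OF proj(2)[OF that]]]) simp
      qed
    qed
    then obtain N where N: "card U' = card k ^ N"
      "\<And>g :: 'a \<Rightarrow> real. sum g k = 0 \<Longrightarrow>
        (\<Sum>x\<in>U'. g (l * B x x)) = (- 1) ^ N * (\<Sum>x\<in>U'. g (B x x))"
      by blast
    have bij: "bij_betw (\<lambda>(u, t). u + t *\<^sub>V v) (U' \<times> k) U"
    proof (rule bij_betw_byWitness[where f' = "\<lambda>x. (x + (- (B x v / a)) *\<^sub>V v, B x v / a)"])
      show "\<forall>p\<in>U' \<times> k. (\<lambda>x. (x + (- (B x v / a)) *\<^sub>V v, B x v / a)) ((\<lambda>(u, t). u + t *\<^sub>V v) p) = p"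
      proof
        fix p assume "p \<in> U' \<times> k"
        then obtain u t where p: "p = (u, t)" and ut: "u \<in> U'" "t \<in> k" by blast
        have "B (u + t *\<^sub>V v) v = t * a"
          using ut by (simp add: Badd Bscale U'D a_def)
        then show "(\<lambda>x. (x + (- (B x v / a)) *\<^sub>V v, B x v / a)) ((\<lambda>(u, t). u + t *\<^sub>V v) p) = p"
          using a by (simp add: p)
      qed
    qed (auto simp: Uadd Uscale U'D v proj proj(1)[simplified])
    have decomp: "(\<Sum>x\<in>U. h (B x x)) = (\<Sum>u\<in>U'. \<Sum>t\<in>k. h (B u u + a * t\<^sup>2))" for h :: "'a \<Rightarrow> real"
    proof -
      have "(\<Sum>x\<in>U. h (B x x)) = (\<Sum>(u, t)\<in>U' \<times> k. h (B (u + t *\<^sub>V v) (u + t *\<^sub>V v)))"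
        using sum.reindex_bij_betw[OF bij, of "\<lambda>x. h (B x x)"] by (simp add: case_prod_beta)
      also have "\<dots> = (\<Sum>u\<in>U'. \<Sum>t\<in>k. h (B (u + t *\<^sub>V v) (u + t *\<^sub>V v)))"
        by (simp add: sum.cartesian_product)
      also have "\<dots> = (\<Sum>u\<in>U'. \<Sum>t\<in>k. h (B u u + a * t\<^sup>2))"
        by (intro sum.cong refl arg_cong[where f = h])
           (simp add: Badd Badd2 Bscale Bscale2 U'D a_def power2_eq_square mult_ac)
      finally show ?thesis .
    qed
    show ?thesis
    proof (intro exI[of _ "Suc N"] conjI allI impI)
      show "card U = card k ^ Suc N"
        using bij_betw_same_card[OF bij] N(1) by (simp add: card_cartesian_product mult.commute)
      fix g :: "'a \<Rightarrow> real" assume g: "sum g k = 0"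
      have "(\<Sum>x\<in>U. g (l * B x x)) = (\<Sum>u\<in>U'. \<Sum>t\<in>k. g (l * (B u u + a * t\<^sup>2)))"
        by (rule decomp)
      also have "\<dots> = (\<Sum>t\<in>k. \<Sum>u\<in>U'. g (l * B u u + l * a * t\<^sup>2))"
        by (subst sum.swap) (simp add: algebra_simps)
      \<comment> \<open>For fixed \<open>t\<close>, the term \<open>l * a * t\<^sup>2\<close> is
        absorbed into the weight. The shifted weight still has sum 0, which is why the induction
        hypothesis quantifies over all such weights.\<close>
      also have "\<dots> = (\<Sum>t\<in>k. (- 1) ^ N * (\<Sum>u\<in>U'. g (B u u + l * a * t\<^sup>2)))"
      proof (rule sum.cong[OF refl])
        fix t assume "t \<in> k"
        then have "(\<Sum>c\<in>k. g (l * a * t\<^sup>2 + 1 * c)) = 0"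
          using g by (subst sum_affine) (auto intro: mult l a square one)
        then have "(\<Sum>c\<in>k. g (c + l * a * t\<^sup>2)) = 0" by (simp add: add.commute)
        then show "(\<Sum>u\<in>U'. g (l * B u u + l * a * t\<^sup>2)) = (- 1) ^ N * (\<Sum>u\<in>U'. g (B u u + l * a * t\<^sup>2))"
          by (rule N(2))
      qed
      also have "\<dots> = (- 1) ^ N * (\<Sum>u\<in>U'. \<Sum>t\<in>k. g (B u u + l * a * t\<^sup>2))"
        by (subst sum.swap) (simp add: sum_distrib_left)
      \<comment> \<open>The remaining \<open>l\<close> in front of \<open>a * t\<^sup>2\<close> is
        removed at the price of one more sign, that of the dimension spanned by
        \<open>v\<close>.\<close>
      also have "(\<Sum>u\<in>U'. \<Sum>t\<in>k. g (B u u + l * a * t\<^sup>2)) =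
          (\<Sum>u\<in>U'. - (\<Sum>t\<in>k. g (B u u + a * t\<^sup>2)))"
      proof (rule sum.cong[OF refl])
        fix u
        have "(\<Sum>t\<in>k. g (B u u + a * t\<^sup>2)) + (\<Sum>t\<in>k. g (B u u + a * (l * t\<^sup>2))) = 0"
          using sum_squares_nonsquare[OF l, of "\<lambda>c. g (B u u + a * c)"] sum_affine[OF Bk[of u u] a, of g] g
          by simp
        then show "(\<Sum>t\<in>k. g (B u u + l * a * t\<^sup>2)) = - (\<Sum>t\<in>k. g (B u u + a * t\<^sup>2))"
          by (simp add: mult_ac)
      qed
      also have "\<dots> = - (\<Sum>x\<in>U. g (B x x))"
        by (simp add: decomp sum_negf)
      finally show "(\<Sum>x\<in>U. g (l * B x x)) = (- 1) ^ Suc N * (\<Sum>x\<in>U. g (B x x))"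
        by simp
    qed
  qed
qed

text \<open>A nonzero linear functional takes every value equally often: translating along
  \<open>v\<close> shifts its values by any chosen \<open>c\<close>, and averaging over
  \<open>c\<close> brings in the full sum of \<open>h\<close> over \<open>k\<close>.\<close>

lemma sum_functional:
  fixes scale :: "'a \<Rightarrow> 'v::{ab_group_add, finite} \<Rightarrow> 'v" and f :: "'v \<Rightarrow> 'a" and h :: "'a \<Rightarrow> real"
  assumes "\<And>x. f x \<in> k" "\<And>x y. f (x + y) = f x + f y" "\<And>c x. c \<in> k \<Longrightarrow> f (scale c x) = c * f x"
    and "f v = 1" "sum h k = 0"
  shows "(\<Sum>x\<in>UNIV. h (f x)) = 0"
proof -
  have shift: "(\<Sum>x\<in>UNIV. h (f x)) = (\<Sum>x\<in>UNIV. h (f x + c))" if "c \<in> k" for c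
  proof -
    have "(\<Sum>x\<in>UNIV. h (f x)) = (\<Sum>x\<in>UNIV. h (f (x + scale c v)))"
      by (rule sum.reindex_bij_witness[of _ "\<lambda>x. x + scale c v" "\<lambda>x. x - scale c v"]) auto
    then show ?thesis using that assms(2-4) by simp
  qed
  have "real (card k) * (\<Sum>x\<in>UNIV. h (f x)) = (\<Sum>c\<in>k. \<Sum>x\<in>UNIV. h (f x + c))"
    unfolding sum_constant[symmetric] by (rule sum.cong[OF refl]) (rule shift)
  also have "\<dots> = (\<Sum>x\<in>UNIV. \<Sum>c\<in>k. h (f x + 1 * c))"
    by (subst sum.swap) simp
  also have "\<dots> = 0"
    using assms(1,5) by (simp only: sum_affine[OF _ one] one_neq_zero not_False_eq_True) simp
  finally show ?thesis using card_ge_3 by simp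
qed

end

section \<open>Degree over a subfield and survival of nonsquares\<close>

lemma (in finite_subfield) card_UNIV_power:
  assumes "finite (UNIV :: 'a set)"
  obtains r where "CARD('a) = card k ^ r"
proof -
  obtain \<phi> :: "'a \<Rightarrow> 'a" where phi: "\<And>x. \<phi> x \<in> k" "\<And>x y. \<phi> (x + y) = \<phi> x + \<phi> y"
    "\<And>c x. c \<in> k \<Longrightarrow> \<phi> (c * x) = c * \<phi> x" "\<phi> 1 = 1"
    using exists_functional[OF assms] by blast
  obtain l where l: "l \<in> k" "l \<notin> (\<lambda>x. x\<^sup>2) ` k"
    by (rule exists_nonsquare)
  \<comment> \<open>The trace-type form \<open>\<phi> (x y)\<close> is non-degenerate, so its diagonalization yields the degree.\<close>
  have nondeg: "x = 0" if "\<And>y. y \<in> UNIV \<Longrightarrow> \<phi> (x * y) = 0" for x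
    using that[of "inverse x"] phi(4) by (cases "x = 0") auto
  have "\<exists>r. CARD('a) = card k ^ r \<and>
    (\<forall>g :: 'a \<Rightarrow> real. sum g k = 0 \<longrightarrow>
      (\<Sum>x\<in>UNIV. g (l * \<phi> (x * x))) = (- 1) ^ r * (\<Sum>x\<in>UNIV. g (\<phi> (x * x))))"
    by (rule quadratic_sum_nonsquare[where scale = "(*)" and B = "\<lambda>x y. \<phi> (x * y)",
          OF vector_space_over_itself.vector_space_axioms l assms])
       (auto simp: phi algebra_simps intro: nondeg)
  then show ?thesis using that by blast
qed

lemma card_roots_of_unity_le:
  assumes "n > 0"
  shows "finite {x::'a::field. x ^ n = 1}" "card {x::'a. x ^ n = 1} \<le> n"
proof -
  define P where "P = monom (1::'a) n - 1"
  have P: "{x. x ^ n = 1} = {x. poly P x = 0}" by (simp add: P_def poly_monom)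
  have "poly P 0 \<noteq> 0" using assms by (simp add: P_def poly_monom power_0_left)
  then have "P \<noteq> 0" by auto
  then show "finite {x::'a. x ^ n = 1}" unfolding P by (rule poly_roots_finite)
  have "card {x::'a. x ^ n = 1} \<le> degree P"
    unfolding P by (rule card_poly_roots_bound[OF \<open>P \<noteq> 0\<close>])
  also have "\<dots> \<le> n"
    unfolding P_def by (rule degree_diff_le) (simp_all add: degree_monom_le)
  finally show "card {x::'a. x ^ n = 1} \<le> n" .
qed

text \<open>Euler's criterion by counting: the nonzero squares are roots of X^h - 1 with h half the
  order of the multiplicative group, and there are already h of them.\<close>

lemma square_iff_power_eq_1:
  fixes x :: "'a::{field, finite}"
  assumes "(2::'a) \<noteq> 0" "x \<noteq> 0"
  shows "x \<in> range (\<lambda>x. x\<^sup>2) \<longleftrightarrow> x ^ ((CARD('a) - 1) div 2) = 1"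
proof -
  interpret U: finite_subfield "UNIV :: 'a set"
    by unfold_locales (use assms(1) in auto)
  let ?h = "(CARD('a) - 1) div 2" and ?S = "(\<lambda>x::'a. x\<^sup>2) ` (UNIV - {0})"
  have h: "CARD('a) - 1 = 2 * ?h" "card ?S = ?h"
    using U.card_squares by auto
  have h0: "?h > 0" using U.card_ge_3 h(1) by simp
  have "card {y::'a. y ^ ?h = 1} \<le> card ?S"
    using card_roots_of_unity_le[OF h0] h(2) by simp
  moreover have "?S \<subseteq> {y. y ^ ?h = 1}"
  proof
    fix y assume "y \<in> ?S"
    then obtain z where z: "z \<noteq> 0" "y = z\<^sup>2" by auto
    have "y ^ ?h = z ^ (CARD('a) - 1)" unfolding z(2) power_mult[symmetric] h(1)[symmetric] ..
    then show "y \<in> {y. y ^ ?h = 1}"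
      using U.power_card_minus_1[of z] z by simp
  qed
  moreover have "finite {y::'a. y ^ ?h = 1}" by simp
  ultimately have "?S = {y. y ^ ?h = 1}" by (metis card_seteq)
  then have "x \<in> ?S \<longleftrightarrow> x ^ ?h = 1" by blast
  moreover have "x \<in> range (\<lambda>x. x\<^sup>2) \<longleftrightarrow> x \<in> ?S" using assms(2) by auto
  ultimately show ?thesis by simp
qed

text \<open>If the degree were even, \<open>(card k)\<^sup>2 - 1\<close> would divide the order of
  the multiplicative group. As \<open>card k + 1\<close> is even, half that order is a multiple of
  \<open>card k - 1\<close>, so Euler's criterion makes \<open>l\<close> a square.\<close>

lemma odd_extension_degree:
  fixes k :: "'a::{field, finite} set"
  assumes "finite_subfield k" "l \<in> k" "l \<notin> range (\<lambda>x. x\<^sup>2)" "CARD('a) = card k ^ r"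
  shows "odd r"
proof
  interpret finite_subfield k by fact
  assume "even r"
  then obtain s where s: "r = 2 * s" by (elim evenE)
  have l0: "l \<noteq> 0" using assms(3) by force
  obtain j where j: "card k - 1 = 2 * j" using card_squares by blast
  then have q0: "card k = 2 * j + 1" using card_ge_3 by simp
  have "(card k)\<^sup>2 - 1 dvd ((card k)\<^sup>2) ^ s - 1"
  proof -
    have "int ((card k)\<^sup>2) - 1 dvd int ((card k)\<^sup>2) ^ s - 1 ^ s"
      by (subst power_diff_sumr2) simp
    moreover have "(card k)\<^sup>2 \<ge> 1" "((card k)\<^sup>2) ^ s \<ge> 1" using q0 by simp_all
    ultimately have "int ((card k)\<^sup>2 - 1) dvd int (((card k)\<^sup>2) ^ s - 1)"
      by (simp add: of_nat_diff)
    then show ?thesis by (simp only: of_nat_dvd_iff)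
  qed
  moreover have "(card k)\<^sup>2 - 1 = 2 * ((card k - 1) * (j + 1))"
    unfolding q0 by (simp add: power2_eq_square algebra_simps)
  ultimately have "2 * ((card k - 1) * (j + 1)) dvd CARD('a) - 1"
    using assms(4) s by (simp add: power_mult)
  then obtain w where "CARD('a) - 1 = 2 * ((card k - 1) * (j + 1)) * w" by (elim dvdE)
  then have "(CARD('a) - 1) div 2 = (card k - 1) * ((j + 1) * w)"
    by (simp only: mult.assoc nonzero_mult_div_cancel_left[of 2])
  then have "l ^ ((CARD('a) - 1) div 2) = 1"
    using power_card_minus_1[OF assms(2) l0] by (simp only: power_mult power_one)
  then show False using square_iff_power_eq_1[OF two_neq_0 l0] assms(3) by simp
qed

text \<open>Fourier-type inversion over the functionals \<open>\<beta> u\<close>: the weight \<open>h\<close> has sum \<open>0\<close> on \<open>k\<close>,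
  so summing \<open>h (\<beta> u w)\<close> over all \<open>u\<close> detects \<open>w = 0\<close>.\<close>

lemma fibre_card_nonsquare:
  fixes k :: "'a::{field, finite} set" and D :: "'a ^ 'n \<Rightarrow> 'a ^ 'n \<Rightarrow> 'a ^ 'n"
  assumes "finite_subfield k"
    and l: "l \<in> k" "l \<notin> range (\<lambda>t. t\<^sup>2)"
    and Dadd: "\<And>x y z. D (x + y) z = D x z + D y z"
    and Dscale: "\<And>c x y. c \<in> k \<Longrightarrow> D (c *s x) y = c *s D x y"
    and Dsym: "\<And>x y. D x y = D y x"
    and D0: "\<And>x y. D x y = 0 \<Longrightarrow> x = 0 \<or> y = 0"
  shows "real (card {x. l *s D x x = z}) - 1 = (- 1) ^ CARD('n) * (real (card {x. D x x = z}) - 1)"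
proof -
  interpret finite_subfield k by fact
  have lk: "l \<notin> (\<lambda>t. t\<^sup>2) ` k" using l(2) by blast
  obtain r where r: "CARD('a) = card k ^ r" by (rule card_UNIV_power) simp
  have "odd r" by (rule odd_extension_degree[OF assms(1) l r])
  obtain \<phi> :: "'a \<Rightarrow> 'a" where phi: "\<And>x. \<phi> x \<in> k" "\<And>x y. \<phi> (x + y) = \<phi> x + \<phi> y"
    "\<And>c x. c \<in> k \<Longrightarrow> \<phi> (c * x) = c * \<phi> x" "\<phi> 1 = 1"
    using exists_functional[OF finite_class.finite_UNIV] by blast
  \<comment> \<open>The dot product followed by \<open>\<phi>\<close> supplies enough
    \<open>k\<close>-linear functionals to separate vectors, indexed by the vectors \<open>u\<close>
    themselves.\<close>
  define \<beta> where "\<beta> u w = \<phi> (\<Sum>i\<in>UNIV. u $ i * w $ i)" for u w :: "'a ^ 'n"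
  have bsym: "\<beta> u w = \<beta> w u" for u w by (simp add: \<beta>_def mult.commute)
  have bk: "\<beta> u w \<in> k" for u w by (simp add: \<beta>_def phi)
  have badd: "\<beta> (u + u') w = \<beta> u w + \<beta> u' w" for u u' w
    by (simp add: \<beta>_def distrib_right sum.distrib phi)
  have bscale: "\<beta> (c *s u) w = c * \<beta> u w" if "c \<in> k" for c u w
    by (simp add: \<beta>_def mult.assoc sum_distrib_left[symmetric] phi that)
  have badd2: "\<beta> u (w + w') = \<beta> u w + \<beta> u w'" for u w w'
    using badd[of w w' u] by (simp add: bsym)
  have bscale2: "\<beta> u (c *s w) = c * \<beta> u w" if "c \<in> k" for c u w
    using bscale[OF that, of w u] by (simp add: bsym)
  have b0: "\<beta> 0 w = 0" "\<beta> u 0 = 0" for u w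
    using bscale[OF zero, of 0 w] bscale2[OF zero, of u 0] by simp_all
  have bdiff2: "\<beta> u (w - w') = \<beta> u w - \<beta> u w'" for u w w'
    using badd2[of u "w - w'" w'] by simp
  have b1: "\<exists>v. \<beta> v w = 1" if "w \<noteq> 0" for w
  proof -
    obtain j where j: "w $ j \<noteq> 0" using \<open>w \<noteq> 0\<close> by (metis vec_eq_iff zero_index)
    have "(\<Sum>i\<in>UNIV. axis j (inverse (w $ j)) $ i * w $ i) = 1"
      using j by (simp add: axis_def if_distrib[of "\<lambda>x. x * _"] cong: if_cong)
    then show ?thesis using phi(4) unfolding \<beta>_def by metis
  qed
  have Dadd2: "D x (y + z) = D x y + D x z" for x y z
    using Dadd[of y z x] by (simp add: Dsym)
  have Dscale2: "D x (c *s y) = c *s D x y" if "c \<in> k" for c x y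
    using Dscale[OF that, of y x] by (simp add: Dsym)
  let ?q = "real (card k)"
  define Q where "Q = real CARD('a ^ 'n)"
  \<comment> \<open>This is the sum of all nontrivial additive characters of \<open>k\<close>,
    written without complex numbers.\<close>
  define h where "h c = (if c = 0 then ?q else 0) - 1" for c :: 'a
  have hsum: "sum h k = 0"
    using finite zero by (simp add: h_def sum_subtractf)
  \<comment> \<open>The index \<open>u = 0\<close> is left out because it gives the zero form, to
    which the comparison for non-degenerate forms cannot be applied.\<close>
  have S: "(\<Sum>u\<in>UNIV - {0}. h (\<beta> u w)) = (if w = 0 then Q * (?q - 1) else 0) - (?q - 1)" for w
  proof -
    have "(\<Sum>u\<in>UNIV. h (\<beta> u w)) = (if w = 0 then Q * (?q - 1) else 0)"
    proof (cases "w = 0")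
      case True
      then show ?thesis by (simp add: b0 h_def Q_def)
    next
      case False
      then obtain v where "\<beta> v w = 1" using b1 by blast
      then show ?thesis
        using sum_functional[of "\<lambda>u. \<beta> u w" "(*s)" v h] bk badd bscale hsum False by simp
    qed
    then show ?thesis
      by (simp add: sum.remove[of UNIV 0] b0 h_def)
  qed
  have count: "(\<Sum>u\<in>UNIV - {0}. \<Sum>x\<in>UNIV. h (\<beta> u (f x - z))) = Q * (?q - 1) * (real (card {x. f x = z}) - 1)"
    for f :: "'a ^ 'n \<Rightarrow> 'a ^ 'n"
  proof -
    have "(\<Sum>u\<in>UNIV - {0}. \<Sum>x\<in>UNIV. h (\<beta> u (f x - z))) =
        (\<Sum>x\<in>UNIV. (if f x = z then Q * (?q - 1) else 0) - (?q - 1))"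
      by (subst sum.swap) (simp add: S)
    also have "\<dots> = real (card {x. f x = z}) * (Q * (?q - 1)) - Q * (?q - 1)"
      unfolding sum_subtractf by (simp add: sum.If_cases Q_def algebra_simps)
    also have "\<dots> = Q * (?q - 1) * (real (card {x. f x = z}) - 1)"
      by (simp add: algebra_simps)
    finally show ?thesis .
  qed
  have main: "(\<Sum>x\<in>UNIV. h (\<beta> u (l *s D x x - z))) = (- 1) ^ CARD('n) * (\<Sum>x\<in>UNIV. h (\<beta> u (D x x - z)))"
    if "u \<noteq> 0" for u
  proof -
    \<comment> \<open>For \<open>x \<noteq> 0\<close> the additive map \<open>D x\<close> has
      trivial kernel, so it is onto by finiteness and the functional \<open>\<beta> u\<close> takes
      the value 1 on its image.\<close>
    have nondeg: "x = 0" if *: "\<And>y. y \<in> UNIV \<Longrightarrow> \<beta> u (D x y) = 0" for x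
    proof (rule ccontr)
      assume "x \<noteq> 0"
      have "D x (a - b) = D x a - D x b" for a b
        using Dadd2[of x "a - b" b] by simp
      then have "inj (D x)"
        using D0[of x] \<open>x \<noteq> 0\<close> by (metis (no_types, lifting) injI right_minus_eq)
      then have "surj (D x)" by (rule finite_UNIV_inj_surj[OF finite_class.finite_UNIV])
      moreover obtain v where "\<beta> u v = 1" using b1[OF \<open>u \<noteq> 0\<close>] bsym by metis
      ultimately show False using * by (metis UNIV_I one_neq_zero surjD)
    qed
    have "\<exists>N. CARD('a ^ 'n) = card k ^ N \<and>
      (\<forall>g :: 'a \<Rightarrow> real. sum g k = 0 \<longrightarrow>
        (\<Sum>x\<in>UNIV. g (l * \<beta> u (D x x))) = (- 1) ^ N * (\<Sum>x\<in>UNIV. g (\<beta> u (D x x))))"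
      by (rule quadratic_sum_nonsquare[where scale = "(*s)" and B = "\<lambda>x y. \<beta> u (D x y)",
            OF vec.vector_space_axioms l(1) lk finite_class.finite_UNIV])
         (simp_all add: bk Dadd Dadd2 badd2 Dscale Dscale2 bscale2 Dsym nondeg)
    then obtain N where N: "CARD('a ^ 'n) = card k ^ N"
      "\<And>g :: 'a \<Rightarrow> real. sum g k = 0 \<Longrightarrow>
        (\<Sum>x\<in>UNIV. g (l * \<beta> u (D x x))) = (- 1) ^ N * (\<Sum>x\<in>UNIV. g (\<beta> u (D x x)))"
      by blast
    have "card k ^ N = card k ^ (r * CARD('n))"
      using N(1) r by (simp add: power_mult)
    then have "N = r * CARD('n)"
      using card_ge_3 by simp
    \<comment> \<open>The dimension over \<open>k\<close> is \<open>r\<close> times the length of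
      the vectors, and the odd factor \<open>r\<close> does not affect parity.\<close>
    then have sgn: "(- 1 :: real) ^ N = (- 1) ^ CARD('n)"
      using \<open>odd r\<close> by (simp add: power_mult)
    have "(\<Sum>c\<in>k. h (- \<beta> u z + 1 * c)) = 0"
      using hsum by (subst sum_affine) (auto intro: one uminus bk)
    then have "(\<Sum>c\<in>k. h (c - \<beta> u z)) = 0" by simp
    from N(2)[OF this] show ?thesis
      by (simp add: sgn bdiff2 bscale2 l(1))
  qed
  have "Q * (?q - 1) * (real (card {x. l *s D x x = z}) - 1) =
      (- 1) ^ CARD('n) * (Q * (?q - 1) * (real (card {x. D x x = z}) - 1))"
    unfolding count[symmetric] by (subst sum_distrib_left, rule sum.cong) (simp_all add: main)
  moreover have "Q * (?q - 1) \<noteq> 0" using card_ge_3 by (simp add: Q_def)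
  ultimately show ?thesis by simp
qed

section \<open>Fixed fields and norms\<close>

text \<open>Translation by 1 permutes the field, so comparing the sums of all elements shows that
  the cardinality is zero in it.\<close>

lemma CHAR_eq_prime:
  assumes "CARD('a::{field, finite}) = p ^ m" "prime p"
  shows "CHAR('a) = p"
proof -
  have "(\<Sum>x\<in>UNIV. x + (1::'a)) = (\<Sum>x\<in>UNIV. x)"
    by (rule sum.reindex_bij_witness[of _ "\<lambda>x. x - 1" "\<lambda>x. x + 1"]) auto
  then have "of_nat CARD('a) = (0::'a)" by (simp add: sum.distrib)
  then have "of_nat p = (0::'a)" using assms(1) by simp
  then have "CHAR('a) dvd p" by (simp add: of_nat_eq_0_iff_char_dvd)
  moreover have "CHAR('a) \<noteq> 1" by simp
  ultimately show ?thesis using assms(2) by (metis prime_nat_iff)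
qed

lemma power_prime_power_add:
  fixes x y :: "'a::{field, finite}"
  assumes "CARD('a) = p ^ m" "prime p"
  shows "(x + y) ^ (p ^ i) = x ^ (p ^ i) + y ^ (p ^ i)"
  using CHAR_eq_prime[OF assms] assms(2) by (intro freshmans_dream') auto

text \<open>These are the properties of a power of an odd prime that matter later: additivity yields
  a fixed subfield, and oddness makes \<open>c ^ (\<sigma> + 1)\<close> an even power, hence a
  square unchanged under negation of \<open>c\<close>.\<close>

locale field_power_automorphism =
  fixes \<sigma> :: nat and T :: "'a::{field, finite} itself"
  assumes power_add: "((x::'a) + y) ^ \<sigma> = x ^ \<sigma> + y ^ \<sigma>"
    and odd_exponent: "odd \<sigma>"
    and two: "(2::'a) \<noteq> 0"
begin

lemma power_diff: "((x::'a) - y) ^ \<sigma> = x ^ \<sigma> - y ^ \<sigma>"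
  using power_add[of "x - y" y] by simp

sublocale fixed: finite_subfield "{c::'a. c ^ \<sigma> = c}"
  by unfold_locales (auto simp: power_diff power_mult_distrib power_inverse two)

sublocale univ: finite_subfield "UNIV :: 'a set"
  by unfold_locales (auto simp: two)

lemma two_power: "(2::'a) ^ (\<sigma> + 1) = 4"
  using power_add[of 1 1] by simp

lemma norm_is_square: "(c::'a) ^ (\<sigma> + 1) \<in> range (\<lambda>x. x\<^sup>2)"
proof -
  obtain b where "\<sigma> = 2 * b + 1" using odd_exponent by (elim oddE)
  then have "\<sigma> + 1 = 2 * (b + 1)" by simp
  then have "c ^ (\<sigma> + 1) = (c ^ (b + 1))\<^sup>2" by (simp only: power_mult mult.commute)
  then show ?thesis by blast
qed

lemma uminus_norm: "(- c :: 'a) ^ (\<sigma> + 1) = c ^ (\<sigma> + 1)"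
  using odd_exponent by simp

section \<open>Consequences of a kernel consisting of 1 and -1\<close>

context
  assumes kernel: "\<And>c::'a. c ^ (\<sigma> + 1) = 1 \<Longrightarrow> c = 1 \<or> c = - 1"
begin

lemma norm_eq_iff: "(c::'a) ^ (\<sigma> + 1) = d ^ (\<sigma> + 1) \<longleftrightarrow> c = d \<or> c = - d"
proof
  assume eq: "c ^ (\<sigma> + 1) = d ^ (\<sigma> + 1)"
  show "c = d \<or> c = - d"
  proof (cases "d = 0")
    case True
    then show ?thesis using eq by auto
  next
    case False
    then have "(c / d) ^ (\<sigma> + 1) = 1" using eq by (simp add: power_divide)
    then show ?thesis using kernel[of "c / d"] False by (auto simp: field_simps)
  qed
qed (use uminus_norm in auto)

text \<open>Both \<open>c ^ (\<sigma> + 1)\<close> and squaring are 2-to-1 on nonzero elements. The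
  first image lies in the second because \<sigma> + 1 is even, so the images coincide.\<close>

lemma square_is_norm:
  assumes "(x::'a) \<noteq> 0" "x \<in> range (\<lambda>x. x\<^sup>2)"
  obtains c where "c \<noteq> 0" "x = c ^ (\<sigma> + 1)"
proof -
  let ?N = "\<lambda>c::'a. c ^ (\<sigma> + 1)" and ?S = "(\<lambda>x::'a. x\<^sup>2) ` (UNIV - {0})"
  have "to_1_on 2 ?N (UNIV - {0})"
    unfolding to_1_on_def
  proof
    fix y assume "y \<in> ?N ` (UNIV - {0})"
    then obtain d where d: "d \<noteq> 0" "y = ?N d" by blast
    have "{c \<in> UNIV - {0}. ?N c = y} = {d, - d}"
      using d(1) unfolding d(2) norm_eq_iff by auto
    then show "card {c \<in> UNIV - {0}. ?N c = y} = 2"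
      using univ.neq_uminus[OF d(1)] by simp
  qed
  then have "card (?N ` (UNIV - {0})) = card ?S"
    using card_to_1_on[of 2 ?N "UNIV - {0}"] univ.card_squares by simp
  moreover have "?N ` (UNIV - {0}) \<subseteq> ?S"
  proof
    fix y assume "y \<in> ?N ` (UNIV - {0})"
    then obtain c where c: "c \<noteq> 0" "y = ?N c" by blast
    obtain z where z: "?N c = z\<^sup>2" using norm_is_square by blast
    have "z \<noteq> 0"
    proof
      assume "z = 0"
      then have "?N c = 0" using z by simp
      then show False using c(1) by simp
    qed
    then show "y \<in> ?S" using c z by auto
  qed
  ultimately have "?N ` (UNIV - {0}) = ?S"
    by (intro card_subset_eq) auto
  moreover have "x \<in> ?S" using assms by auto
  ultimately have "x \<in> ?N ` (UNIV - {0})" by simp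
  then show ?thesis using that by blast
qed

text \<open>If \<open>l\<close> had a root \<open>m\<close> outside the fixed field \<open>k\<close>, then \<open>c ^ (\<sigma> + 1)\<close> would be the norm
  from \<open>k(m)\<close> to \<open>k\<close>, which is \<open>(card k + 1)\<close>-to-\<open>1\<close>, contradicting the small kernel.\<close>

lemma nonsquare_extends:
  assumes l: "l ^ \<sigma> = l" "l \<notin> (\<lambda>x. x\<^sup>2) ` {c::'a. c ^ \<sigma> = c}"
  shows "l \<notin> range (\<lambda>x::'a. x\<^sup>2)"
proof
  let ?k = "{c::'a. c ^ \<sigma> = c}"
  assume "l \<in> range (\<lambda>x. x\<^sup>2)"
  then obtain m where m: "l = m\<^sup>2" by blast
  have "(m ^ \<sigma>)\<^sup>2 = m\<^sup>2"
    using l(1) unfolding m by (simp add: power_mult[symmetric] mult.commute)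
  then have "m ^ \<sigma> = m \<or> m ^ \<sigma> = - m" by (simp add: power2_eq_iff)
  moreover have "m ^ \<sigma> \<noteq> m" using l(2) m by blast
  ultimately have ms: "m ^ \<sigma> = - m" by blast
  \<comment> \<open>Pairs over the fixed field parametrize the quadratic extension generated by
    \<open>m\<close>.\<close>
  define f where "f = (\<lambda>(x, y). x + y * m)"
  have f0: "x = 0 \<and> y = 0" if "x \<in> ?k" "y \<in> ?k" "x + y * m = 0" for x y
  proof -
    have "y = 0"
    proof (rule ccontr)
      assume "y \<noteq> 0"
      have "y * m = - x" using that(3) by (metis add_eq_0_iff)
      then have "m = - x / y" using \<open>y \<noteq> 0\<close> by (metis nonzero_mult_div_cancel_left)
      then have "m \<in> ?k" using fixed.divide[OF fixed.uminus[OF that(1)] that(2)] by simp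
      then show False using \<open>m ^ \<sigma> \<noteq> m\<close> by simp
    qed
    then show ?thesis using that by simp
  qed
  have inj: "inj_on f (?k \<times> ?k)"
  proof (rule inj_onI, clarify)
    fix x y x' y' assume a: "x ^ \<sigma> = x" "y ^ \<sigma> = y" "x' ^ \<sigma> = x'" "y' ^ \<sigma> = y'" "f (x, y) = f (x', y')"
    have "(x - x') + (y - y') * m = 0" using a(5) by (simp add: f_def algebra_simps)
    then show "x = x' \<and> y = y'"
      using f0[of "x - x'" "y - y'"] a by (auto simp: power_diff)
  qed
  let ?A = "?k \<times> ?k - {(0, 0)}" and ?g = "\<lambda>p. (f p) ^ (\<sigma> + 1)"
  \<comment> \<open>With K the size of the fixed field, this reads K^2 - 1 \<le> 2 (K - 1),
    impossible for K \<ge> 3. The 2 comes from the kernel; the values stay in the fixed field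
    because \<open>(x + y * m) ^ (\<sigma> + 1)\<close> is
    \<open>x\<^sup>2 - y\<^sup>2 * l\<close>.\<close>
  have "card ?A \<le> 2 * card (?k - {0})"
  proof (rule card_le_mult_fibre)
    show "?g ` ?A \<subseteq> ?k - {0}"
    proof
      fix c assume "c \<in> ?g ` ?A"
      then obtain x y where xy: "x \<in> ?k" "y \<in> ?k" "(x, y) \<noteq> (0, 0)" and c: "c = ?g (x, y)"
        by blast
      have "c = (x + y * m) ^ \<sigma> * (x + y * m)"
        by (simp add: c f_def mult.commute)
      also have "(x + y * m) ^ \<sigma> = x - y * m"
        using xy by (simp add: power_add power_mult_distrib ms)
      finally have "c = x\<^sup>2 - y\<^sup>2 * l"
        by (simp add: m power2_eq_square algebra_simps)
      then have "c \<in> ?k"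
        using fixed.diff[OF fixed.square[OF xy(1)] fixed.mult[OF fixed.square[OF xy(2)], of l]] l(1) by simp
      moreover have "c \<noteq> 0"
        using f0[OF xy(1,2)] xy(3) by (auto simp: c f_def)
      ultimately show "c \<in> ?k - {0}" by simp
    qed
    show "card {p \<in> ?A. ?g p = y} \<le> 2" for y
    proof (cases "{p \<in> ?A. ?g p = y} = {}")
      case False
      then obtain p where p: "p \<in> ?A" "?g p = y" by blast
      have "f ` {p \<in> ?A. ?g p = y} \<subseteq> {f p, - f p}"
        using p(2) norm_eq_iff by auto
      then have "card (f ` {p \<in> ?A. ?g p = y}) \<le> card {f p, - f p}"
        by (rule card_mono[rotated]) simp
      also have "\<dots> \<le> 2" by (simp add: card_insert_le_m1)
      finally have "card (f ` {p \<in> ?A. ?g p = y}) \<le> 2" .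
      moreover have "inj_on f {p \<in> ?A. ?g p = y}"
        by (rule inj_on_subset[OF inj]) blast
      ultimately show ?thesis by (simp only: card_image)
    next
      case True
      then show ?thesis by (simp only: card.empty)
    qed
  qed auto
  moreover have "card ?A = card ?k * card ?k - 1"
    using fixed.zero by (simp add: card_cartesian_product)
  moreover have "card (?k - {0}) = card ?k - 1"
    using fixed.zero by simp
  ultimately have "card ?k * card ?k - 1 \<le> 2 * (card ?k - 1)" by simp
  moreover have "3 * card ?k \<le> card ?k * card ?k"
    using fixed.card_ge_3 by simp
  ultimately show False using fixed.card_ge_3 by linarith
qed

end

end

text \<open>Bezout and Fermat reduce the exponent to the gcd e, which bounds the count above.
  Conversely, raising to the power e sends the q - 1 nonzero elements to at most (q - 1) / e values,
  with fibres no larger than the kernel.\<close>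

lemma card_roots_of_unity:
  assumes "CARD('a::{field, finite}) = q" "d > 0"
  shows "card {c::'a. c ^ d = 1} = gcd d (q - 1)"
proof -
  let ?e = "gcd d (q - 1)"
  have e0: "?e > 0" using assms(2) by simp
  have q: "q - 1 > 0"
    using card_mono[of "UNIV :: 'a set" "{0, 1}"] assms(1) by simp
  have fermat: "c ^ (q - 1) = 1" if "c \<noteq> 0" for c :: 'a
    using power_card_minus_1_eq_1[of "UNIV :: 'a set" c] that assms(1) by simp
  have "c ^ d = 1 \<longleftrightarrow> c ^ ?e = 1" for c :: 'a
  proof
    assume c: "c ^ d = 1"
    then have "c \<noteq> 0" using assms(2) by (auto simp: power_0_left)
    obtain x y where "d * x = (q - 1) * y + ?e"
      using bezout_nat[of d "q - 1"] assms(2) by auto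
    then have "(c ^ d) ^ x = (c ^ (q - 1)) ^ y * c ^ ?e"
      by (simp only: power_mult[symmetric] power_add[symmetric])
    then show "c ^ ?e = 1" using c fermat[OF \<open>c \<noteq> 0\<close>] by simp
  next
    assume c: "c ^ ?e = 1"
    obtain w where "d = ?e * w" using gcd_dvd1 by (rule dvdE)
    then show "c ^ d = 1" using c by (metis power_mult power_one)
  qed
  then have eq: "{c::'a. c ^ d = 1} = {c. c ^ ?e = 1}" by blast
  obtain w where w: "q - 1 = ?e * w" using gcd_dvd2 by (rule dvdE)
  then have w0: "w > 0" using q by (cases w) auto
  let ?K = "{c::'a. c ^ ?e = 1}"
  have "card (UNIV - {0::'a}) \<le> card ?K * card {z::'a. z ^ w = 1}"
  proof (rule card_le_mult_fibre)
    show "(\<lambda>c. c ^ ?e) ` (UNIV - {0}) \<subseteq> {z::'a. z ^ w = 1}"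
      using fermat by (auto simp: power_mult[symmetric] w[symmetric] simp del: One_nat_def)
    show "card {c \<in> UNIV - {0}. c ^ ?e = z} \<le> card ?K" for z :: 'a
    proof (cases "{c \<in> UNIV - {0}. c ^ ?e = z} = {}")
      case False
      then obtain b where b: "b \<noteq> 0" "b ^ ?e = z" by blast
      show ?thesis
      proof (rule card_inj_on_le)
        show "inj_on (\<lambda>c. c / b) {c \<in> UNIV - {0}. c ^ ?e = z}"
          using b(1) by (auto simp: inj_on_def)
        show "(\<lambda>c. c / b) ` {c \<in> UNIV - {0}. c ^ ?e = z} \<subseteq> ?K"
          using b by (auto simp: power_divide)
      qed simp
    next
      case True
      then show ?thesis by (metis card.empty zero_le)
    qed
  qed auto
  also have "\<dots> \<le> card ?K * w"
    using card_roots_of_unity_le(2)[OF w0, where 'a = 'a] by simp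
  finally have "?e * w \<le> card ?K * w" using assms(1) w by simp
  then have "?e \<le> card ?K" using w0 by simp
  then show ?thesis
    unfolding eq using card_roots_of_unity_le(2)[OF e0, where 'a = 'a] by simp
qed

section \<open>Planar semiquadratic maps\<close>

lemma vec_neq_uminus:
  fixes x :: "'a::field ^ 'n"
  assumes "(2::'a) \<noteq> 0" "x \<noteq> 0"
  shows "x \<noteq> - x"
proof
  assume "x = - x"
  then have "x $ i = - (x $ i)" for i by (metis vector_uminus_component)
  then have "2 * x $ i = 0" for i by (metis add.right_inverse mult_2)
  then have "x $ i = 0" for i using assms(1) by simp
  then show False using assms(2) by (simp add: vec_eq_iff)
qed

lemma span_singleton_eq_iff:
  fixes x y :: "'a::field ^ 'n"
  assumes "x \<noteq> 0"
  shows "vec.span {x} = vec.span {y} \<longleftrightarrow> (\<exists>c. c \<noteq> 0 \<and> x = c *s y)"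
proof
  assume "vec.span {x} = vec.span {y}"
  then have "x \<in> vec.span {y}" using vec.span_base[of x "{x}"] by simp
  then obtain c where "x = c *s y" by (auto simp: vec.span_singleton)
  then show "\<exists>c. c \<noteq> 0 \<and> x = c *s y" using assms by auto
next
  assume "\<exists>c. c \<noteq> 0 \<and> x = c *s y"
  then obtain c where c: "c \<noteq> 0" "x = c *s y" by blast
  have "y = inverse c *s x" using c by simp
  then show "vec.span {x} = vec.span {y}"
    unfolding vec.span_eq using c(2) by (auto simp: vec.span_singleton)
qed

lemma SQH_polarization_add:
  assumes "F \<in> SQH \<sigma>"
  shows "polarization F (x + y) z = polarization F x z + polarization F y z"
proof -
  have "polarization F (x + y) z $ i = polarization F x z $ i + polarization F y z $ i" for i
  proof -
    have "semiquadratic_form \<sigma> (\<lambda>x. F x $ i)" using assms by (simp add: SQH_def)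
    then obtain b where b: "sesquilinear_form \<sigma> b"
      and F: "\<And>x y. F (x + y) $ i - F x $ i - F y $ i = b x y + b y x"
      unfolding semiquadratic_form_def by blast
    have "b (x + y) z = b x z + b y z"
      using b by (simp add: sesquilinear_form_def Vector_Spaces.linear_iff)
    moreover have "b z (x + y) = b z x + b z y"
      using b by (simp add: sesquilinear_form_def additive_def)
    ultimately show ?thesis by (simp add: polarization_def F)
  qed
  then show ?thesis by (simp add: vec_eq_iff)
qed

text \<open>On the fixed field semilinearity is linearity, so both terms \<open>b x y\<close> and
  \<open>b y x\<close> scale by the same factor.\<close>

lemma SQH_polarization_scale:
  assumes "F \<in> SQH \<sigma>" "c ^ \<sigma> = c"
  shows "polarization F (c *s x) y = c *s polarization F x y"
proof -
  have "polarization F (c *s x) y $ i = c * polarization F x y $ i" for i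
  proof -
    have "semiquadratic_form \<sigma> (\<lambda>x. F x $ i)" using assms by (simp add: SQH_def)
    then obtain b where b: "sesquilinear_form \<sigma> b"
      and F: "\<And>x y. F (x + y) $ i - F x $ i - F y $ i = b x y + b y x"
      unfolding semiquadratic_form_def by blast
    have "b (c *s x) y = c * b x y"
      using b by (simp add: sesquilinear_form_def Vector_Spaces.linear_iff)
    moreover have "b y (c *s x) = c * b y x"
      using b assms(2) by (simp add: sesquilinear_form_def)
    ultimately show ?thesis by (simp add: polarization_def F distrib_left)
  qed
  then show ?thesis by (simp add: vec_eq_iff)
qed

lemma polarization_commute: "polarization F x y = polarization F y x"
  by (simp add: polarization_def add.commute)

lemma to_1_on_if_inj_induced_map:
  fixes F :: "'a::{field, finite} ^ 'n \<Rightarrow> 'a ^ 'n"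
  assumes F: "F \<in> SQH \<sigma>" and F0: "\<And>x. F x = 0 \<Longrightarrow> x = 0"
    and inj: "inj_on (induced_map F) proj_space"
  shows "to_1_on (gcd (\<sigma> + 1) (CARD('a) - 1)) F (UNIV - {0})"
  unfolding to_1_on_def
proof
  fix y assume "y \<in> F ` (UNIV - {0})"
  then obtain x where x: "x \<noteq> 0" "y = F x" by blast
  let ?C = "{c::'a. c ^ (\<sigma> + 1) = 1}"
  have "{z \<in> UNIV - {0}. F z = y} = (\<lambda>c. c *s x) ` ?C"
  proof (intro equalityI subsetI)
    fix z assume "z \<in> {z \<in> UNIV - {0}. F z = y}"
    then have z: "z \<noteq> 0" "F z = F x" using x by auto
    have "vec.span {z} \<in> proj_space" "vec.span {x} \<in> proj_space"
      using x(1) z(1) by (auto simp: proj_space_eq)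
    moreover have "induced_map F (vec.span {z}) = induced_map F (vec.span {x})"
      by (simp add: induced_map_span[OF F] z)
    ultimately have "vec.span {z} = vec.span {x}" using inj by (simp add: inj_on_def)
    then obtain c where c: "z = c *s x" using span_singleton_eq_iff[OF z(1)] by blast
    have "c ^ (\<sigma> + 1) *s F x = 1 *s F x"
      using z(2) unfolding c SQH_scale[OF F] by simp
    then have "c ^ (\<sigma> + 1) = 1"
      using F0[of x] x(1) by (metis vec.scale_right_imp_eq vector_mul_rcancel)
    then show "z \<in> (\<lambda>c. c *s x) ` ?C" using c by blast
  next
    fix z assume "z \<in> (\<lambda>c. c *s x) ` ?C"
    then obtain c where c: "c ^ (\<sigma> + 1) = 1" "z = c *s x" by blast
    then have "c \<noteq> 0" by auto
    then show "z \<in> {z \<in> UNIV - {0}. F z = y}"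
      using x c by (simp add: SQH_scale[OF F] del: power_Suc add_Suc_right)
  qed
  moreover have "inj_on (\<lambda>c. c *s x) ?C"
    using x(1) by (auto simp: inj_on_def)
  ultimately show "card {z \<in> UNIV - {0}. F z = y} = gcd (\<sigma> + 1) (CARD('a) - 1)"
    using card_roots_of_unity[OF refl, of "\<sigma> + 1", where 'a = 'a] by (simp only: card_image)
qed

context field_power_automorphism
begin

context
  fixes F :: "'a ^ 'n \<Rightarrow> 'a ^ 'n"
  assumes F: "F \<in> SQH \<sigma>"
begin

lemma F_zero: "F 0 = 0"
  using SQH_scale[OF F, of 0 0] by simp

lemma F_uminus: "F (- x) = F x"
  using SQH_scale[OF F, of "- 1" x] odd_exponent by simp

lemma polarization_diag: "polarization F x x = 2 *s F x"
proof -
  have "F (2 *s x) = 4 *s F x"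
    using SQH_scale[OF F, of 2 x] by (simp only: two_power)
  moreover have "x + x = 2 *s x" by (simp add: vec_eq_iff)
  ultimately have "polarization F x x = 4 *s F x - F x - F x"
    by (simp only: polarization_def)
  then show ?thesis by (simp add: vec_eq_iff)
qed

lemma polarization_add_diff: "polarization F (x + y) (x - y) = 2 *s (F x - F y)"
proof -
  note add = SQH_polarization_add[OF F]
  have add2: "polarization F u (v + w) = polarization F u v + polarization F u w" for u v w
    using add[of v w u] by (simp only: polarization_commute[of F u])
  have "polarization F u (x - y) = polarization F u x - polarization F u y" for u
    using add2[of u "x - y" y] by simp
  then have "polarization F (x + y) (x - y) = polarization F x x - polarization F y y"
    by (simp add: add polarization_commute[of F y x])
  then show ?thesis by (simp add: polarization_diag vec.scale_right_diff_distrib)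
qed

text \<open>Since 2 is invertible, every pair of vectors is a sum and a difference
  \<open>x + y\<close>, \<open>x - y\<close>; zero divisors of the polarization thus correspond to
  vectors with equal images that do not agree up to sign.\<close>

lemma presemifield_iff:
  "commutative_presemifield (polarization F) \<longleftrightarrow> (\<forall>x y. F x = F y \<longrightarrow> x = y \<or> x = - y)"
proof
  assume L: "commutative_presemifield (polarization F)"
  show "\<forall>x y. F x = F y \<longrightarrow> x = y \<or> x = - y"
  proof (intro allI impI)
    fix x y assume "F x = F y"
    then have "polarization F (x + y) (x - y) = 0" by (simp add: polarization_add_diff)
    then have "x + y = 0 \<or> x - y = 0" using L unfolding commutative_presemifield_def by blast
    then show "x = y \<or> x = - y" by (auto simp: eq_neg_iff_add_eq_0)
  qed
next
  assume R: "\<forall>x y. F x = F y \<longrightarrow> x = y \<or> x = - y"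
  have "u = 0 \<or> v = 0" if "polarization F u v = 0" for u v
  proof -
    define x y where "x = inverse 2 *s (u + v)" and "y = inverse 2 *s (u - v)"
    have half: "inverse 2 * a + inverse 2 * a = a" for a :: 'a
      using two by (simp add: distrib_right[symmetric] mult_2[symmetric] mult.assoc[symmetric])
    have "x + y = u" "x - y = v"
      using half by (simp_all add: x_def y_def vec_eq_iff algebra_simps)
    then have "2 *s (F x - F y) = 0" using polarization_add_diff[of x y] that by simp
    then have "F x = F y" using two by simp
    then have "x = y \<or> x = - y" using R by blast
    then show ?thesis using \<open>x + y = u\<close> \<open>x - y = v\<close> by auto
  qed
  moreover have "polarization F x (y + z) = polarization F x y + polarization F x z" for x y z
    using SQH_polarization_add[OF F, of y z x] by (simp only: polarization_commute[of F x])
  ultimately show "commutative_presemifield (polarization F)"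
    using SQH_polarization_add[OF F] polarization_commute[of F]
    unfolding commutative_presemifield_def additive_def by blast
qed

text \<open>\<open>F\<close> is even, so the fibre through a nonzero \<open>y\<close> contains the
  two vectors \<open>y\<close> and \<open>- y\<close>; having size 2 means containing nothing
  else.\<close>

lemma two_to_1_iff:
  "(\<forall>x. F x = 0 \<longleftrightarrow> x = 0) \<and> to_1_on 2 F (UNIV - {0}) \<longleftrightarrow>
    (\<forall>x y. F x = F y \<longrightarrow> x = y \<or> x = - y)"
proof (intro iffI allI impI)
  fix x y
  assume L: "(\<forall>x. F x = 0 \<longleftrightarrow> x = 0) \<and> to_1_on 2 F (UNIV - {0})" and eq: "F x = F y"
  show "x = y \<or> x = - y"
  proof (cases "y = 0")
    case True
    then have "F x = 0" using L eq by simp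
    then show ?thesis using L True by blast
  next
    case False
    then have "F y \<noteq> 0" using L by blast
    then have "x \<noteq> 0" using eq F_zero by auto
    have "card {z \<in> UNIV - {0}. F z = F y} = 2"
      using L False by (simp add: to_1_on_def)
    moreover have "{y, - y} \<subseteq> {z \<in> UNIV - {0}. F z = F y}"
      using False F_uminus by simp
    moreover have "card {y, - y} = 2"
      using vec_neq_uminus[OF two False] by simp
    ultimately have "{y, - y} = {z \<in> UNIV - {0}. F z = F y}"
      by (intro card_subset_eq) auto
    then show ?thesis using eq \<open>x \<noteq> 0\<close> by blast
  qed
next
  assume R: "\<forall>x y. F x = F y \<longrightarrow> x = y \<or> x = - y"
  have zero: "F x = 0 \<longleftrightarrow> x = 0" for x
    using R F_zero by (metis neg_equal_0_iff_equal)
  have "card {z \<in> UNIV - {0}. F z = F x} = 2" if "x \<noteq> 0" for x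
  proof -
    have "{z \<in> UNIV - {0}. F z = F x} = {x, - x}"
      using R that F_uminus by auto
    then show ?thesis using vec_neq_uminus[OF two that] by simp
  qed
  then show "(\<forall>x. F x = 0 \<longleftrightarrow> x = 0) \<and> to_1_on 2 F (UNIV - {0})"
    using zero by (auto simp: to_1_on_def)
qed

section \<open>Planar maps and the induced map on projective space\<close>

context
  assumes planar: "\<And>x y. F x = F y \<Longrightarrow> x = y \<or> x = - y"
begin

lemma F_eq_0_iff: "F x = 0 \<longleftrightarrow> x = 0"
  using planar[of x 0] F_zero by auto

text \<open>Scaling a nonzero vector, here the all-ones vector, by such a \<open>c\<close> preserves
  its image, so it can only change the sign.\<close>

lemma planar_kernel:
  assumes "(c::'a) ^ (\<sigma> + 1) = 1"
  shows "c = 1 \<or> c = - 1"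
proof -
  let ?x = "\<chi> i. 1 :: 'a ^ 'n"
  have "F (c *s ?x) = F ?x" using SQH_scale[OF F, of c ?x] assms by simp
  then have "c *s ?x = ?x \<or> c *s ?x = - ?x" by (rule planar)
  then show ?thesis by (auto simp: vec_eq_iff)
qed

lemma planar_fibre_nonsquare:
  assumes l: "l ^ \<sigma> = l" "l \<notin> range (\<lambda>x::'a. x\<^sup>2)" and "y \<noteq> 0"
  shows "card {x. F x = l *s F y} = (if even CARD('n) then 2 else 0)"
proof -
  have l0: "l \<noteq> 0" using l(2) by force
  have "real (card {x. l *s polarization F x x = z}) - 1 =
      (- 1) ^ CARD('n) * (real (card {x. polarization F x x = z}) - 1)" for z
  proof (rule fibre_card_nonsquare[OF fixed.finite_subfield_axioms, where D = "polarization F"])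
    show "x = 0 \<or> y = 0" if "polarization F x y = 0" for x y
      using presemifield_iff planar that unfolding commutative_presemifield_def by blast
  qed (use l SQH_polarization_add[OF F] SQH_polarization_scale[OF F] polarization_commute in auto)
  \<comment> \<open>This target turns the left fibre into that of \<open>F\<close> over
    \<open>F y\<close>, of known size 2, and the right one into the fibre over
    \<open>l *s F y\<close>.\<close>
  from this[of "l *s (2 *s F y)"]
  have "real (card {x. l *s (2 *s F x) = l *s (2 *s F y)}) - 1 =
      (- 1) ^ CARD('n) * (real (card {x. 2 *s F x = l *s (2 *s F y)}) - 1)"
    by (simp only: polarization_diag)
  moreover have "l *s (2 *s F x) = l *s (2 *s F y) \<longleftrightarrow> F x = F y" for x
    using l0 two by (simp only: vector_mul_lcancel) simp
  moreover have "2 *s F x = l *s (2 *s F y) \<longleftrightarrow> F x = l *s F y" for x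
  proof -
    have "l *s (2 *s F y) = 2 *s (l *s F y)" by (simp add: mult.commute)
    then show ?thesis using two by (simp only: vector_mul_lcancel) simp
  qed
  ultimately have "real (card {x. F x = F y}) - 1 = (- 1) ^ CARD('n) * (real (card {x. F x = l *s F y}) - 1)"
    by simp
  moreover have "{x. F x = F y} = {y, - y}" using planar F_uminus by auto
  moreover have "card {y, - y} = 2" using vec_neq_uminus[OF two \<open>y \<noteq> 0\<close>] by simp
  ultimately show ?thesis by (cases "even CARD('n)") auto
qed

text \<open>Every nonzero scalar is \<open>c ^ (\<sigma> + 1)\<close> or \<open>l * c ^ (\<sigma> + 1)\<close>.\<close>

lemma planar_proportional:
  assumes l: "l \<notin> range (\<lambda>x::'a. x\<^sup>2)"
    and "x \<noteq> 0" "vec.span {F x} = vec.span {F y}"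
  obtains c where "c \<noteq> 0" "F x = F (c *s y)" | c where "c \<noteq> 0" "F x = l *s F (c *s y)"
proof -
  obtain m where m: "m \<noteq> 0" "F x = m *s F y"
    using span_singleton_eq_iff[of "F x" "F y"] assms(2,3) F_eq_0_iff by auto
  show ?thesis
  proof (cases "m \<in> range (\<lambda>x. x\<^sup>2)")
    case True
    then obtain c where "c \<noteq> 0" "m = c ^ (\<sigma> + 1)"
      using square_is_norm[OF planar_kernel m(1)] by blast
    then show ?thesis using that(1) m(2) SQH_scale[OF F] by metis
  next
    case False
    then obtain t where t: "t \<noteq> 0" "m = l * t\<^sup>2"
      using univ.nonsquare_mult_square[of l m] l by auto
    then obtain c where c: "c \<noteq> 0" "t\<^sup>2 = c ^ (\<sigma> + 1)"
      using square_is_norm[OF planar_kernel, of "t\<^sup>2"] by auto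
    have "F x = l *s F (c *s y)"
      unfolding SQH_scale[OF F] m(2) t(2) c(2) by simp
    then show ?thesis using that(2) c(1) by blast
  qed
qed

lemma planar_span_eq:
  assumes "x \<noteq> 0" "c \<noteq> 0" "F x = F (c *s y)"
  shows "vec.span {x} = vec.span {y}"
proof -
  have "x = c *s y \<or> x = (- c) *s y" using planar[OF assms(3)] by simp
  then show ?thesis
    using span_singleton_eq_iff[OF assms(1)] assms(2) by (metis neg_equal_0_iff_equal)
qed

lemma exists_fixed_nonsquare:
  obtains l :: 'a where "l ^ \<sigma> = l" "l \<notin> range (\<lambda>x. x\<^sup>2)"
proof -
  obtain l where "l \<in> {c::'a. c ^ \<sigma> = c}" "l \<notin> (\<lambda>x. x\<^sup>2) ` {c::'a. c ^ \<sigma> = c}"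
    by (rule fixed.exists_nonsquare)
  then show ?thesis
    using that nonsquare_extends[OF planar_kernel, of l] by blast
qed

lemma planar_bij:
  assumes "odd CARD('n)"
  shows "bij_betw (induced_map F) proj_space proj_space"
proof -
  obtain l :: 'a where l: "l ^ \<sigma> = l" "l \<notin> range (\<lambda>x. x\<^sup>2)" by (rule exists_fixed_nonsquare)
  have inj: "inj_on (induced_map F) proj_space"
  proof (rule inj_onI)
    fix L L' assume "L \<in> proj_space" "L' \<in> proj_space" and eq: "induced_map F L = induced_map F L'"
    then obtain x y where x: "x \<noteq> 0" "L = vec.span {x}" and y: "y \<noteq> 0" "L' = vec.span {y}"
      by (auto simp: proj_space_eq)
    have "vec.span {F x} = vec.span {F y}"
      using eq unfolding x(2) y(2) induced_map_span[OF F] .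
    with l(2) x(1) show "L = L'"
    proof (cases rule: planar_proportional)
      case (1 c)
      then show ?thesis using planar_span_eq x y by simp
    next
      case (2 c)
      \<comment> \<open>This is where the parity enters: the fibre size 1 + (-1)^n is zero.\<close>
      have "card {x. F x = l *s F (c *s y)} = 0"
        using planar_fibre_nonsquare[OF l, of "c *s y"] y(1) 2(1) assms by simp
      then have "{x. F x = l *s F (c *s y)} = {}" by (simp only: card_0_eq finite_class.finite)
      then show ?thesis using 2(2) by blast
    qed
  qed
  moreover have "induced_map F ` proj_space \<subseteq> proj_space"
    using induced_map_proj_space[OF F] F_eq_0_iff by blast
  ultimately show ?thesis
    using endo_inj_surj[of proj_space "induced_map F"] by (simp add: bij_betw_def)
qed

lemma planar_two_to_1:
  assumes "even CARD('n)"
  shows "to_1_on 2 (induced_map F) proj_space"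
  unfolding to_1_on_def
proof
  obtain l :: 'a where l: "l ^ \<sigma> = l" "l \<notin> range (\<lambda>x. x\<^sup>2)" by (rule exists_fixed_nonsquare)
  have l0: "l \<noteq> 0" using l(2) by force
  fix M assume "M \<in> induced_map F ` proj_space"
  then obtain y where y: "y \<noteq> 0" and M: "M = vec.span {F y}"
    by (auto simp: proj_space_eq induced_map_span[OF F])
  have "card {x. F x = l *s F y} = 2"
    using planar_fibre_nonsquare[OF l y] assms by simp
  then have "{x. F x = l *s F y} \<noteq> {}" by (metis card.empty zero_neq_numeral)
  \<comment> \<open>The second point over \<open>M\<close> is spanned by a preimage of
    \<open>l *s F y\<close>. It differs from the point of \<open>y\<close>, since rescaling
    \<open>y\<close> multiplies \<open>F y\<close> by squares only.\<close>
  then obtain z where z: "F z = l *s F y" by blast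
  have Fy: "F y \<noteq> 0" using y F_eq_0_iff by simp
  have z0: "z \<noteq> 0" using z Fy l0 F_zero by auto
  have "vec.span {z} \<noteq> vec.span {y}"
  proof
    assume "vec.span {z} = vec.span {y}"
    then obtain c where "z = c *s y" using span_singleton_eq_iff[OF z0] by blast
    then have "c ^ (\<sigma> + 1) *s F y = l *s F y" using z SQH_scale[OF F] by simp
    then have "c ^ (\<sigma> + 1) = l" using Fy by (simp only: vector_mul_rcancel) simp
    then show False using norm_is_square[of c] l(2) by simp
  qed
  moreover have "{L \<in> proj_space. induced_map F L = M} = {vec.span {y}, vec.span {z}}"
  proof (intro equalityI subsetI)
    fix L assume "L \<in> {L \<in> proj_space. induced_map F L = M}"
    then obtain x where x: "x \<noteq> 0" "L = vec.span {x}" "vec.span {F x} = vec.span {F y}"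
      by (auto simp: proj_space_eq induced_map_span[OF F] M)
    from l(2) x(1,3) show "L \<in> {vec.span {y}, vec.span {z}}"
    proof (cases rule: planar_proportional)
      case (1 c)
      then show ?thesis using planar_span_eq x by simp
    next
      case (2 c)
      \<comment> \<open>Replacing \<open>l *s F y\<close> by \<open>F z\<close> reduces the
        nonsquare case to the square case for \<open>z\<close>.\<close>
      have "F x = F (c *s z)"
        unfolding 2(2) SQH_scale[OF F] z by (simp add: mult.commute)
      then show ?thesis using planar_span_eq[OF x(1) 2(1)] x(2) by simp
    qed
  next
    fix L assume "L \<in> {vec.span {y}, vec.span {z}}"
    moreover have "vec.span {y} \<in> proj_space" "vec.span {z} \<in> proj_space"
      using y z0 unfolding proj_space_eq by blast+
    moreover have "induced_map F (vec.span {y}) = M"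
      by (simp only: induced_map_span[OF F] M)
    moreover have "vec.span {F z} = vec.span {F y}"
      using span_singleton_eq_iff[of "F z" "F y"] z l0 z0 F_eq_0_iff[of z] by blast
    then have "induced_map F (vec.span {z}) = M"
      by (simp only: induced_map_span[OF F] M)
    ultimately show "L \<in> {L \<in> proj_space. induced_map F L = M}" by blast
  qed
  ultimately show "card {L \<in> proj_space. induced_map F L = M} = 2" by simp
qed

end

end

end

theorem theorem1p10:
  fixes F :: "'a::{field, finite} ^ 'n \<Rightarrow> 'a ^ 'n" and p m q n \<sigma> :: nat
  assumes "prime p" and "q = p ^ m" and "CARD('a) = q" and "odd q"
    and "CARD('n) = n"
    and "\<sigma> \<in> {p ^ i | i. i < m}"
    and "F \<in> SQH \<sigma>"
  shows
    "(commutative_presemifield (polarization F) \<longleftrightarrow>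
        (\<forall>x. F x = 0 \<longleftrightarrow> x = 0) \<and> to_1_on 2 F (UNIV - {0})) \<and>
     ((\<forall>x. F x = 0 \<longleftrightarrow> x = 0) \<and> to_1_on 2 F (UNIV - {0}) \<longrightarrow>
        (odd n \<longrightarrow> bij_betw (induced_map F) proj_space proj_space) \<and>
        (even n \<longrightarrow> to_1_on 2 (induced_map F) proj_space)) \<and>
     ((\<forall>x. F x = 0 \<longrightarrow> x = 0) \<and> bij_betw (induced_map F) proj_space proj_space \<longrightarrow>
        to_1_on (gcd (\<sigma> + 1) (q - 1)) F (UNIV - {0}))"
proof -
  obtain i where i: "\<sigma> = p ^ i" "i < m" using assms(6) by blast
  have card: "CARD('a) = p ^ m" using assms(2,3) by simp
  \<comment> \<open>The bound \<open>i < m\<close> rules out \<open>m = 0\<close>, for which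
    \<open>q = 1\<close> is odd whatever \<open>p\<close> is.\<close>
  have "odd p" using assms(2,4) i(2) by simp
  have "CHAR('a) = p" by (rule CHAR_eq_prime[OF card assms(1)])
  then have "(2::'a) \<noteq> 0"
    using of_nat_eq_0_iff_char_dvd[of 2, where 'a = 'a] \<open>odd p\<close> assms(1) primes_dvd_imp_eq[OF assms(1) two_is_prime_nat]
    by auto
  then interpret field_power_automorphism \<sigma> "TYPE('a)"
    using power_prime_power_add[OF card assms(1)] \<open>odd p\<close> by unfold_locales (auto simp: i)
  note F = assms(7)
  have "bij_betw (induced_map F) proj_space proj_space" if "odd n" "\<forall>x y. F x = F y \<longrightarrow> x = y \<or> x = - y"
    using planar_bij[OF F] that assms(5) by blast
  moreover have "to_1_on 2 (induced_map F) proj_space" if "even n" "\<forall>x y. F x = F y \<longrightarrow> x = y \<or> x = - y"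
    using planar_two_to_1[OF F] that assms(5) by blast
  moreover have "to_1_on (gcd (\<sigma> + 1) (q - 1)) F (UNIV - {0})"
    if "\<forall>x. F x = 0 \<longrightarrow> x = 0" "bij_betw (induced_map F) proj_space proj_space"
    using to_1_on_if_inj_induced_map[OF F] that assms(3) by (simp add: bij_betw_def)
  ultimately show ?thesis
    unfolding presemifield_iff[OF F] two_to_1_iff[OF F] by blast
qed

end
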